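(* Fix a prime power $q$. (i) Let $r\to\infty$ through odd integers, and let $N=(3r-1)/2$. For a uniformly random alternating bilinear form $B:\Lambda^2\mathbb F_q^N\to\mathbb F_q$, the number $X_{N,r}$ of totally isotropic $r$-dimensional subspaces satisfies $$\mathbb E X_{N,r}\to C_q,\qquad\mathbb P(X_{N,r}>0)\le C_q\,q^{-(r^2-1)/8}\to0 .$$ Hence $X_{N,r}\to0$ in probability. (ii) Let $N=2r-1$ and choose $B=(B_1,B_2):\Lambda^2\mathbb F_q^N\to\mathbb F_q^2$ uniformly at random. Every pair $(B_1,B_2)$ has a common totally isotropic $r$-dimensional subspace, so the number $X_{N,r}$ of common totally isotropic $r$-dimensional subspaces satisfies $X_{N,r}\ge1$ deterministically, while $$\frac{\mathbb E\bigl[X_{N,r}(X_{N,r}-1)\bigr]}{(\mathbb E X_{N,r})^2}\ge\frac{r-1}{C_q}.$$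
   Context: A subspace $H$ is totally isotropic for a linear map $B:\Lambda^2\mathbb F_q^N\to\mathbb F_q^m$ if $B(\Lambda^2H)=0$ (equivalently, all $m$ alternating forms vanish on $H\times H$). Uniform means uniform in the finite space $\mathrm{Hom}(\Lambda^2\mathbb F_q^N,\mathbb F_q^m)$. $C_q=\prod_{j\ge1}(1-q^{-j})^{-1}$. *)

theory Defs
  imports "HOL-Probability.Probability" "HOL-Library.Function_Algebras"
begin

text \<open>Since the dimension varies, vectors are functions on \<^typ>\<open>nat\<close>, and
  $F^N$ is the set of those functions that vanish from index $N$ on. Addition is the pointwise
  one of Function\_Algebras.\<close>

definition coord_scale :: "'a::field \<Rightarrow> (nat \<Rightarrow> 'a) \<Rightarrow> nat \<Rightarrow> 'a" where
  "coord_scale c x = (\<lambda>i. c * x i)"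

global_interpretation coord: vector_space coord_scale
  by unfold_locales (auto simp: coord_scale_def fun_eq_iff algebra_simps)

definition coord_space :: "nat \<Rightarrow> (nat \<Rightarrow> 'a::field) set" where
  "coord_space N = {x. \<forall>i\<ge>N. x i = 0}"

text \<open>The space $\mathrm{Hom}(\Lambda^2 F^N, W)$, seen through the universal property of
  $\Lambda^2$ as the set of alternating bilinear maps $F^N \times F^N \to W$. The parameter
  \<open>s\<close> is the scalar multiplication of $W$: it is \<^term>\<open>(*)\<close> for $W = F$ and
  \<^term>\<open>(*s)\<close> for $W = F^m$. The last clause only fixes the junk values outside
  $F^N \times F^N$, so that each such map is represented exactly once.\<close>

definition alternating_maps ::
  "('a::field \<Rightarrow> 'w::ab_group_add \<Rightarrow> 'w) \<Rightarrow> nat \<Rightarrow> ((nat \<Rightarrow> 'a) \<Rightarrow> (nat \<Rightarrow> 'a) \<Rightarrow> 'w) set" where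
  "alternating_maps s N = {B.
     (\<forall>x\<in>coord_space N. \<forall>y\<in>coord_space N. \<forall>z\<in>coord_space N.
        B (x + y) z = B x z + B y z \<and> B z (x + y) = B z x + B z y) \<and>
     (\<forall>c. \<forall>x\<in>coord_space N. \<forall>y\<in>coord_space N.
        B (coord_scale c x) y = s c (B x y) \<and> B x (coord_scale c y) = s c (B x y)) \<and>
     (\<forall>x\<in>coord_space N. B x x = 0) \<and>
     (\<forall>x y. x \<notin> coord_space N \<or> y \<notin> coord_space N \<longrightarrow> B x y = 0)}"

definition totally_isotropic ::
  "((nat \<Rightarrow> 'a::field) \<Rightarrow> (nat \<Rightarrow> 'a) \<Rightarrow> 'w::ab_group_add) \<Rightarrow> (nat \<Rightarrow> 'a) set \<Rightarrow> bool" where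
  "totally_isotropic B H \<longleftrightarrow> (\<forall>x\<in>H. \<forall>y\<in>H. B x y = 0)"

definition subspaces_of_dim :: "nat \<Rightarrow> nat \<Rightarrow> (nat \<Rightarrow> 'a::field) set set" where
  "subspaces_of_dim N r = {H. coord.subspace H \<and> H \<subseteq> coord_space N \<and> coord.dim H = r}"

definition num_isotropic ::
  "nat \<Rightarrow> nat \<Rightarrow> ((nat \<Rightarrow> 'a::field) \<Rightarrow> (nat \<Rightarrow> 'a) \<Rightarrow> 'w::ab_group_add) \<Rightarrow> nat" where
  "num_isotropic N r B = card {H \<in> subspaces_of_dim N r. totally_isotropic B H}"

definition C_const :: "nat \<Rightarrow> real" where
  "C_const q = (\<Prod>j. inverse (1 - 1 / real q ^ Suc j))"

text \<open>\<^const>\<open>pmf_of_set\<close> is the uniform distribution only on finite nonempty sets.\<close>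

lemma finite_coord_space: "finite (coord_space N :: (nat \<Rightarrow> 'a::{field,finite}) set)"
proof -
  have "coord_space N \<subseteq> (\<lambda>f i. if i < N then f i else 0) ` (PiE {..<N} (\<lambda>_. UNIV :: 'a set))"
  proof
    fix x :: "nat \<Rightarrow> 'a" assume "x \<in> coord_space N"
    then have "x = (\<lambda>f i. if i < N then f i else 0) (restrict x {..<N})"
      by (auto simp: coord_space_def fun_eq_iff)
    then show "x \<in> (\<lambda>f i. if i < N then f i else 0) ` (PiE {..<N} (\<lambda>_. UNIV :: 'a set))"
      by (intro image_eqI[where x = "restrict x {..<N}"]) auto
  qed
  then show ?thesis
    by (rule finite_subset) (intro finite_imageI finite_PiE; simp)
qed

lemma finite_alternating_maps:
  fixes s :: "'a::{field,finite} \<Rightarrow> 'w::{ab_group_add,finite} \<Rightarrow> 'w"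
  shows "finite (alternating_maps s N)"
proof -
  let ?V = "coord_space N :: (nat \<Rightarrow> 'a) set"
  let ?g = "\<lambda>f x y. if x \<in> ?V \<and> y \<in> ?V then f (x, y) else (0::'w)"
  have "alternating_maps s N \<subseteq> ?g ` (PiE (?V \<times> ?V) (\<lambda>_. UNIV))"
  proof
    fix B assume "B \<in> alternating_maps s N"
    then have "B = ?g (restrict (\<lambda>(x, y). B x y) (?V \<times> ?V))"
      by (auto simp: alternating_maps_def fun_eq_iff)
    then show "B \<in> ?g ` (PiE (?V \<times> ?V) (\<lambda>_. UNIV))"
      by (intro image_eqI[where x = "restrict (\<lambda>(x, y). B x y) (?V \<times> ?V)"]) auto
  qed
  then show ?thesis
    by (rule finite_subset) (intro finite_imageI finite_PiE; simp add: finite_coord_space)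
qed

lemma alternating_maps_nonempty:
  assumes "\<And>c. s c 0 = 0"
  shows "alternating_maps s N \<noteq> {}"
proof -
  have "(\<lambda>_ _. 0) \<in> alternating_maps s N"
    using assms by (simp add: alternating_maps_def)
  then show ?thesis by blast
qed

end

theory Submission
  imports Defs "HOL-Computational_Algebra.Polynomial" "HOL-Real_Asymp.Real_Asymp"
begin

text \<open>A subspace of dimension \<open>r\<close> is isotropic for \<open>w\<close> random forms with probability \<open>q\<close> to the
  power \<open>- w (r choose 2)\<close>, so both expectations are Gaussian binomials times a power of \<open>q\<close>.

  (i) If \<open>H\<close> is isotropic of dimension \<open>r = 2m + 1\<close> in dimension \<open>3m + 1\<close>, then the map
  \<open>H \<rightarrow> (V / H)\<^sup>*\<close> induced by the form has a kernel of dimension at least \<open>m + 1\<close>, which lies in the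
  radical. A union bound over the possible \<open>(m + 1)\<close>-dimensional subspaces of the radical gives the
  estimate.

  (ii) In odd dimension the pencil \<open>B1 + t B2\<close> is singular and has a polynomial kernel vector; its
  coefficients span a common isotropic subspace \<open>L\<close>, and one continues by induction in the common
  orthogonal space of \<open>L\<close>. For the second moment let \<open>Z H\<close> be the group of pairs vanishing on \<open>H\<close>.
  Since \<open>Z H + Z H' \<subseteq> Z (H \<inter> H')\<close>, we have \<open>|Z H \<inter> Z H'| \<ge> |Z H| |Z H'| / |Z (H \<inter> H')|\<close>. There are
  at least \<open>q\<close> to the power \<open>r (r - 1) - k (k - 1)\<close> subspaces \<open>H'\<close> with \<open>dim (H \<inter> H') = k\<close>, so each
  \<open>k = 1, \<dots>, r - 1\<close> contributes at least \<open>1 / C\<^sub>q\<close> to the ratio.\<close>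

section \<open>Counting subspaces\<close>

lemma card_fibres:
  assumes "finite S" "finite T" "g ` S \<subseteq> T"
  shows "card S = (\<Sum>y\<in>T. card {x \<in> S. g x = y})"
  using sum.group[OF assms, of "\<lambda>_. 1::nat"] by simp

text \<open>Every fibre of \<open>f\<close> over its image is a translate of the kernel: this is the
  first isomorphism theorem, counted. Closure under differences makes a nonempty \<open>G\<close> a
  subgroup, so one lemma serves vectors, pairs and spaces of forms.\<close>

lemma card_hom:
  fixes f :: "'b::ab_group_add \<Rightarrow> 'c::ab_group_add"
  assumes "finite G"
    and diff: "\<And>x y. x \<in> G \<Longrightarrow> y \<in> G \<Longrightarrow> x - y \<in> G"
    and hom: "\<And>x y. x \<in> G \<Longrightarrow> y \<in> G \<Longrightarrow> f (x - y) = f x - f y"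
  shows "card G = card {x \<in> G. f x = 0} * card (f ` G)"
proof -
  have fib: "card {x \<in> G. f x = y} = card {x \<in> G. f x = 0}" if y: "y \<in> f ` G" for y
  proof -
    obtain a where a: "a \<in> G" "y = f a" using y by auto
    have z: "0 - x \<in> G" if "x \<in> G" for x
      using that diff by (metis diff_self)
    have f0: "f 0 = 0" using hom[OF a(1) a(1)] by simp
    have fz: "f (0 - x) = - f x" if "x \<in> G" for x
      using hom[of 0 x] that diff[of x x] f0 by simp
    have "bij_betw (\<lambda>x. x - a) {x \<in> G. f x = y} {x \<in> G. f x = 0}"
    \<comment> \<open>The inverse translation is written \<open>x - (0 - a)\<close> instead of
      \<open>x + a\<close>, because closure is available for differences; the two simp rules deleted
      below would turn it back into a sum.\<close>
    proof (rule bij_betwI[where g = "\<lambda>x. x - (0 - a)"])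
      show "(\<lambda>x. x - (0 - a)) \<in> {x \<in> G. f x = 0} \<rightarrow> {x \<in> G. f x = y}"
        using diff hom z fz a by (auto simp del: diff_0 diff_minus_eq_add)
    qed (use diff hom a in auto)
    then show ?thesis by (rule bij_betw_same_card)
  qed
  have "card G = (\<Sum>y\<in>f ` G. card {x \<in> G. f x = y})"
    using card_fibres[of G "f ` G" f] \<open>finite G\<close> by simp
  also have "\<dots> = (\<Sum>y\<in>f ` G. card {x \<in> G. f x = 0})"
    by (rule sum.cong) (auto intro: fib)
  finally show ?thesis by simp
qed

text \<open>The kernel of subtraction on \<open>A \<times> B\<close> is the diagonal copy of
  \<open>A \<inter> B\<close>; for nonempty groups its image is their sum.\<close>

lemma card_times_card:
  fixes A B :: "'b::ab_group_add set"
  assumes "finite A" "finite B"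
    and "\<And>x y. x \<in> A \<Longrightarrow> y \<in> A \<Longrightarrow> x - y \<in> A"
    and "\<And>x y. x \<in> B \<Longrightarrow> y \<in> B \<Longrightarrow> x - y \<in> B"
  shows "card A * card B = card (A \<inter> B) * card ((\<lambda>(x, y). x - y) ` (A \<times> B))"
proof -
  have "card (A \<times> B) =
    card {p \<in> A \<times> B. (\<lambda>(x, y). x - y) p = 0} * card ((\<lambda>(x, y). x - y) ` (A \<times> B))"
    by (rule card_hom) (use assms in \<open>auto simp: algebra_simps\<close>)
  moreover have "{p \<in> A \<times> B. (\<lambda>(x, y). x - y) p = 0} = (\<lambda>x. (x, x)) ` (A \<inter> B)"
    by auto
  moreover have "card ((\<lambda>x. (x, x)) ` (A \<inter> B)) = card (A \<inter> B)"
    by (rule card_image) (auto intro: inj_onI)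
  ultimately show ?thesis by (simp add: card_cartesian_product)
qed

text \<open>Extending by zero, not by \<open>undefined\<close>, keeps these functions inside an
  additive group, so that they can be the target of \<open>card_hom\<close>.\<close>

lemma card_supported_functions:
  assumes "finite P"
  shows "finite {h :: 'p \<Rightarrow> 'w::{zero,finite}. \<forall>p. p \<notin> P \<longrightarrow> h p = 0} \<and>
    card {h :: 'p \<Rightarrow> 'w::{zero,finite}. \<forall>p. p \<notin> P \<longrightarrow> h p = 0} = CARD('w) ^ card P"
proof -
  have "bij_betw (\<lambda>h. restrict h P) {h :: 'p \<Rightarrow> 'w. \<forall>p. p \<notin> P \<longrightarrow> h p = 0} (P \<rightarrow>\<^sub>E (UNIV :: 'w set))"
    by (rule bij_betwI[where g = "\<lambda>f p. if p \<in> P then f p else 0"])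
       (auto simp: fun_eq_iff PiE_def extensional_def)
  from bij_betw_same_card[OF this] bij_betw_finite[OF this] show ?thesis
    using assms by (simp add: card_PiE finite_PiE)
qed

text \<open>Evaluating all \<open>g c\<close> at once is a homomorphism into the functions supported
  on \<open>C\<close>. For field-valued \<open>g\<close> this says that each linear condition lowers
  the dimension by at most one.\<close>

lemma card_common_kernel:
  fixes g :: "'c \<Rightarrow> 'b::ab_group_add \<Rightarrow> 'd::{ab_group_add,finite}"
  assumes "finite G" "finite C"
    and "\<And>x y. x \<in> G \<Longrightarrow> y \<in> G \<Longrightarrow> x - y \<in> G"
    and "\<And>c x y. c \<in> C \<Longrightarrow> x \<in> G \<Longrightarrow> y \<in> G \<Longrightarrow> g c (x - y) = g c x - g c y"
  shows "card G \<le> card {x \<in> G. \<forall>c\<in>C. g c x = 0} * CARD('d) ^ card C"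
proof -
  define f where "f = (\<lambda>x c. if c \<in> C then g c x else 0)"
  have "card G = card {x \<in> G. f x = 0} * card (f ` G)"
    by (rule card_hom) (use assms in \<open>auto simp: f_def fun_eq_iff\<close>)
  moreover have "{x \<in> G. f x = 0} = {x \<in> G. \<forall>c\<in>C. g c x = 0}"
    by (auto simp: f_def fun_eq_iff)
  moreover have "card (f ` G) \<le> CARD('d) ^ card C"
  proof -
    have "f ` G \<subseteq> {h. \<forall>c. c \<notin> C \<longrightarrow> h c = 0}" by (auto simp: f_def)
    from card_mono[OF conjunct1[OF card_supported_functions[OF \<open>finite C\<close>]] this]
    show ?thesis unfolding conjunct2[OF card_supported_functions[OF \<open>finite C\<close>]] .
  qed
  ultimately show ?thesis by (simp only: mult_le_mono2)
qed

section \<open>Sizes of spans over a finite field\<close>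

lemma card_field_gt_1: "CARD('a::{field,finite}) > 1"
proof -
  have "card {0, 1 :: 'a} \<le> CARD('a)" by (rule card_mono) auto
  then show ?thesis by simp
qed

lemma card_coord_space: "card (coord_space N :: (nat \<Rightarrow> 'a::{field,finite}) set) = CARD('a) ^ N"
  using card_supported_functions[of "{..<N}", where 'w = 'a] by (simp add: coord_space_def not_less)

lemma subspace_coord_space: "coord.subspace (coord_space N)"
  by (auto simp: coord.subspace_def coord_space_def coord_scale_def)

text \<open>Each vector of the larger span is \<open>coord_scale k b + x\<close> for a unique pair
  \<open>(k, x)\<close>: two different scalars for one vector would put \<open>b\<close> into
  \<open>coord.span S\<close>.\<close>

lemma finite_card_span_insert:
  fixes b :: "nat \<Rightarrow> 'a::{field,finite}"
  assumes fin: "finite (coord.span S)" and b: "b \<notin> coord.span S"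
  shows "finite (coord.span (insert b S)) \<and>
    card (coord.span (insert b S)) = card (coord.span S) * CARD('a)"
proof -
  let ?f = "\<lambda>(k, x). coord_scale k b + x"
  have "inj_on ?f (UNIV \<times> coord.span S)"
  proof (rule inj_onI, clarsimp)
    fix k x l y assume x: "x \<in> coord.span S" and y: "y \<in> coord.span S"
      and eq: "coord_scale k b + x = coord_scale l b + y"
    have "k = l"
    proof (rule ccontr)
      assume "k \<noteq> l"
      have "coord_scale (k - l) b = y - x"
        using eq by (simp add: coord.scale_left_diff_distrib algebra_simps)
      then have "coord_scale (k - l) b \<in> coord.span S"
        using coord.span_diff[OF y x] by simp
      then have "coord_scale (inverse (k - l)) (coord_scale (k - l) b) \<in> coord.span S"
        by (rule coord.span_scale)
      with \<open>k \<noteq> l\<close> b show False by simp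
    qed
    with eq show "k = l \<and> x = y" by simp
  qed
  moreover have "?f ` (UNIV \<times> coord.span S) = coord.span (insert b S)"
  proof (intro equalityI subsetI)
    fix z assume "z \<in> coord.span (insert b S)"
    then obtain k where "z - coord_scale k b \<in> coord.span S"
      unfolding coord.span_insert by blast
    then show "z \<in> ?f ` (UNIV \<times> coord.span S)"
      by (intro image_eqI[where x = "(k, z - coord_scale k b)"]) auto
  qed (auto simp: coord.span_insert, metis add_diff_cancel_left')
  ultimately show ?thesis
    using fin card_image[of ?f "UNIV \<times> coord.span S"] finite_imageI[of "UNIV \<times> coord.span S" ?f]
    by (simp add: card_cartesian_product mult.commute)
qed

lemma finite_card_span_independent:
  fixes S :: "(nat \<Rightarrow> 'a::{field,finite}) set"
  assumes "finite S" "\<not> coord.dependent S"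
  shows "finite (coord.span S) \<and> card (coord.span S) = CARD('a) ^ card S"
  using assms
proof (induction S rule: finite_induct)
  case (insert b S)
  have "\<not> coord.dependent S" "b \<notin> coord.span S"
    using insert.prems insert.hyps coord.independent_insert[of b S] by auto
  then show ?case using insert.IH insert.hyps finite_card_span_insert[of S b] by simp
qed simp

lemma obtain_basis:
  fixes H :: "(nat \<Rightarrow> 'a::{field,finite}) set"
  assumes "coord.subspace H" "finite H"
  obtains S where "finite S" "S \<subseteq> H" "\<not> coord.dependent S" "coord.span S = H" "card S = coord.dim H"
    "card H = CARD('a) ^ card S"
proof -
  obtain S where S: "S \<subseteq> H" "\<not> coord.dependent S" "H \<subseteq> coord.span S" "card S = coord.dim H"
    by (rule coord.basis_exists)
  have "finite S" using S assms finite_subset by blast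
  moreover have "coord.span S = H" using S assms by (metis coord.span_subspace)
  ultimately show thesis using that[of S] S finite_card_span_independent[of S] by simp
qed

lemma card_eq_pow_dim:
  fixes H :: "(nat \<Rightarrow> 'a::{field,finite}) set"
  assumes "coord.subspace H" "finite H"
  shows "card H = CARD('a) ^ coord.dim H"
  using obtain_basis[OF assms] by metis

lemma dim_eq_iff_card:
  fixes H :: "(nat \<Rightarrow> 'a::{field,finite}) set"
  assumes "coord.subspace H" "finite H"
  shows "coord.dim H = r \<longleftrightarrow> card H = CARD('a) ^ r"
  using card_eq_pow_dim[OF assms] card_field_gt_1[where 'a = 'a] by auto

text \<open>Replaces dimension by cardinality, which is what the group counts compute.\<close>

lemma subspaces_of_dim_alt:
  "subspaces_of_dim N r =
    {H :: (nat \<Rightarrow> 'a::{field,finite}) set. coord.subspace H \<and> H \<subseteq> coord_space N \<and> card H = CARD('a) ^ r}"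
  unfolding subspaces_of_dim_def
  using dim_eq_iff_card finite_subset[OF _ finite_coord_space] by blast

lemma finite_subspaces_of_dim: "finite (subspaces_of_dim N r :: (nat \<Rightarrow> 'a::{field,finite}) set set)"
  by (rule finite_subset[of _ "Pow (coord_space N)"])
     (auto simp: subspaces_of_dim_def finite_coord_space)

text \<open>Lists of \<open>n\<close> vectors of \<open>V\<close> that are linearly independent modulo \<open>U\<close>.\<close>

fun frames :: "(nat \<Rightarrow> 'a::field) set \<Rightarrow> (nat \<Rightarrow> 'a) set \<Rightarrow> nat \<Rightarrow> (nat \<Rightarrow> 'a) list set" where
  "frames U V 0 = {[]}"
| "frames U V (Suc n) = {v # vs | v vs. vs \<in> frames U V n \<and> v \<in> V \<and> v \<notin> coord.span (U \<union> set vs)}"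

lemma frames_subset: "vs \<in> frames U V n \<Longrightarrow> set vs \<subseteq> V"
  by (induction n arbitrary: vs) fastforce+

lemma finite_card_span_frame:
  fixes U :: "(nat \<Rightarrow> 'a::{field,finite}) set"
  assumes "coord.subspace U" "finite U" "vs \<in> frames U V n"
  shows "finite (coord.span (U \<union> set vs)) \<and> card (coord.span (U \<union> set vs)) = card U * CARD('a) ^ n"
  using assms(3)
proof (induction n arbitrary: vs)
  case 0
  then show ?case using assms(2) by (simp add: coord.span_eq_iff[THEN iffD2, OF assms(1)])
next
  case (Suc n)
  then obtain v ws where ws: "vs = v # ws" "ws \<in> frames U V n" "v \<notin> coord.span (U \<union> set ws)"
    by auto
  then show ?case using Suc.IH[OF ws(2)] finite_card_span_insert[of "U \<union> set ws" v] by simp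
qed

lemma span_frame_subset:
  assumes "coord.subspace V" "U \<subseteq> V" "vs \<in> frames U V n"
  shows "coord.span (U \<union> set vs) \<subseteq> V"
  using assms frames_subset[OF assms(3)] by (intro coord.span_minimal) auto

text \<open>A frame is extended by any vector of \<open>V\<close> outside the span of
  \<open>U\<close> and the frame, and the size of that span depends only on the length. Once the
  span fills \<open>V\<close> the factor is \<open>0\<close>, as it should be.\<close>

lemma finite_card_frames:
  fixes U :: "(nat \<Rightarrow> 'a::{field,finite}) set"
  assumes "coord.subspace U" "coord.subspace V" "U \<subseteq> V" "finite V"
  shows "finite (frames U V n) \<and> card (frames U V n) = (\<Prod>i<n. card V - card U * CARD('a) ^ i)"
proof (induction n)
  case (Suc n)
  have finU: "finite U" using assms finite_subset by blast
  let ?W = "\<lambda>vs. V - coord.span (U \<union> set vs)"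
  have eq: "frames U V (Suc n) = (\<lambda>(vs, v). v # vs) ` (SIGMA vs:frames U V n. ?W vs)"
    by auto
  have "card (?W vs) = card V - card U * CARD('a) ^ n" if "vs \<in> frames U V n" for vs
    using finite_card_span_frame[OF assms(1) finU that] span_frame_subset[OF assms(2,3) that]
    by (simp add: card_Diff_subset)
  moreover have "card (frames U V (Suc n)) = card (SIGMA vs:frames U V n. ?W vs)"
    unfolding eq by (rule card_image) (auto intro: inj_onI)
  moreover have "finite (frames U V (Suc n))"
    unfolding eq using Suc assms(4) by (intro finite_imageI finite_SigmaI) auto
  ultimately show ?case using Suc assms(4) by (simp add: card_SigmaI del: frames.simps)
qed simp

lemma span_full_frame:
  fixes H :: "(nat \<Rightarrow> 'a::{field,finite}) set"
  assumes "coord.subspace H" "finite H" "card H = CARD('a) ^ r" "vs \<in> frames {0} H r"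
  shows "coord.span (set vs) = H"
proof -
  have "card (coord.span (set vs)) = card H"
    using finite_card_span_frame[OF _ _ assms(4)] assms(3) by simp
  moreover have "coord.span (set vs) \<subseteq> H"
    using frames_subset[OF assms(4)] assms(1) by (rule coord.span_minimal)
  ultimately show ?thesis using card_subset_eq[OF assms(2)] by blast
qed

text \<open>Independence modulo \<open>U\<close> implies independence modulo any part of
  \<open>U\<close>. Since \<open>W\<close> may be smaller or larger than \<open>V\<close>, this
  moves frames both into and out of a subspace.\<close>

lemma frames_restrict:
  assumes "vs \<in> frames U V n" "set vs \<subseteq> W" "U' \<subseteq> U"
  shows "vs \<in> frames U' W n"
  using assms
proof (induction n arbitrary: vs)
  case (Suc n)
  then obtain v ws where ws: "vs = v # ws" "ws \<in> frames U V n" "v \<notin> coord.span (U \<union> set ws)"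
    by auto
  moreover have "coord.span (U' \<union> set ws) \<subseteq> coord.span (U \<union> set ws)"
    using Suc.prems by (intro coord.span_mono) auto
  ultimately show ?case using Suc.IH[OF ws(2)] Suc.prems by auto
qed simp

text \<open>The Gaussian binomial without division: the frames of the whole space are grouped by the
  subspace they span, and each subspace has equally many.\<close>

lemma card_subspaces_of_dim:
  "card (subspaces_of_dim N r :: (nat \<Rightarrow> 'a::{field,finite}) set set)
      * (\<Prod>i<r. CARD('a) ^ r - CARD('a) ^ i) = (\<Prod>i<r. CARD('a) ^ N - CARD('a) ^ i)"
proof -
  let ?V = "coord_space N :: (nat \<Rightarrow> 'a) set"
  let ?S = "subspaces_of_dim N r :: (nat \<Rightarrow> 'a) set set"
  have fr: "finite (frames {0} W r) \<and> card (frames {0} W r) = (\<Prod>i<r. card W - CARD('a) ^ i)"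
    if "coord.subspace W" "finite W" for W :: "(nat \<Rightarrow> 'a) set"
    using finite_card_frames[of "{0}" W r] that coord.subspace_0[OF that(1)] by simp
  note V = subspace_coord_space[of N, where 'a = 'a] finite_coord_space[of N, where 'a = 'a]
  have "(\<Prod>i<r. CARD('a) ^ N - CARD('a) ^ i) = card (frames {0} ?V r)"
    using fr[OF V] by (simp add: card_coord_space)
  also have "\<dots> = (\<Sum>H\<in>?S. card {vs \<in> frames {0} ?V r. coord.span (set vs) = H})"
  proof (rule card_fibres)
    show "(\<lambda>vs. coord.span (set vs)) ` frames {0} ?V r \<subseteq> ?S"
    proof clarify
      fix vs assume vs: "vs \<in> frames {0} ?V r"
      show "coord.span (set vs) \<in> ?S"
        using finite_card_span_frame[OF _ _ vs] span_frame_subset[OF V(1) _ vs] coord.subspace_0[OF V(1)]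
        by (simp add: subspaces_of_dim_alt)
    qed
  qed (use fr[OF V] finite_subspaces_of_dim in auto)
  also have "\<dots> = (\<Sum>H\<in>?S. (\<Prod>i<r. CARD('a) ^ r - CARD('a) ^ i))"
  proof (rule sum.cong)
    fix H assume "H \<in> ?S"
    then have H: "coord.subspace H" "H \<subseteq> ?V" "card H = CARD('a) ^ r"
      by (auto simp: subspaces_of_dim_alt)
    have finH: "finite H" using H(2) V(2) finite_subset by blast
    have "{vs \<in> frames {0} ?V r. coord.span (set vs) = H} = frames {0} H r" (is "?L = ?R")
    proof (intro equalityI subsetI)
      fix vs assume "vs \<in> ?L"
      then show "vs \<in> ?R"
        using frames_restrict[of vs "{0}" ?V r H "{0}"] coord.span_superset[of "set vs"] by auto
    next
      fix vs assume "vs \<in> ?R"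
      then show "vs \<in> ?L"
        using span_full_frame[OF H(1) finH H(3)] frames_subset[of vs "{0}" H r] H(2)
          frames_restrict[of vs "{0}" H r ?V "{0}"] by auto
    qed
    then show "card {vs \<in> frames {0} ?V r. coord.span (set vs) = H} = (\<Prod>i<r. CARD('a) ^ r - CARD('a) ^ i)"
      using fr[OF H(1) finH] H(3) by simp
  qed simp
  finally show ?thesis by simp
qed

section \<open>Counting alternating maps\<close>

lemma obtain_basis_extension:
  fixes V :: "(nat \<Rightarrow> 'a::{field,finite}) set"
  assumes V: "coord.subspace V" "finite V" and S: "S \<subseteq> V" "\<not> coord.dependent S"
  obtains C where "finite C" "C \<subseteq> V" "S \<inter> C = {}" "\<not> coord.dependent (S \<union> C)" "coord.span (S \<union> C) = V"
    "card V = CARD('a) ^ (card S + card C)"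
proof -
  obtain B where B: "S \<subseteq> B" "B \<subseteq> V" "\<not> coord.dependent B" "V \<subseteq> coord.span B"
    using coord.maximal_independent_subset_extend[OF S] by blast
  have fin: "finite B" using B(2) V(2) finite_subset by blast
  have "coord.span B = V" using B V by (metis coord.span_subspace)
  moreover have "S \<union> (B - S) = B" using B(1) by auto
  moreover have "card S + card (B - S) = card B"
    using fin B(1) by (metis card_Diff_subset card_mono finite_subset le_add_diff_inverse)
  ultimately show thesis
    using that[of "B - S"] B fin finite_card_span_independent[OF fin B(3)] by auto
qed

lemma obtain_subspace_of_card:
  fixes H :: "(nat \<Rightarrow> 'a::{field,finite}) set"
  assumes H: "coord.subspace H" "finite H" and d: "CARD('a) ^ d \<le> card H"
  obtains K where "coord.subspace K" "K \<subseteq> H" "card K = CARD('a) ^ d"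
proof -
  obtain S where S: "finite S" "S \<subseteq> H" "\<not> coord.dependent S" "card H = CARD('a) ^ card S"
    using obtain_basis[OF H] by metis
  have "d \<le> card S" using d S(4) card_field_gt_1[where 'a = 'a] by simp
  then obtain T where T: "T \<subseteq> S" "card T = d" "finite T"
    by (rule obtain_subset_with_card_n)
  have "\<not> coord.dependent T" using S(3) T(1) coord.independent_mono by blast
  then show thesis
    using that[of "coord.span T"] finite_card_span_independent[OF T(3)] T(1,2) S(2) H(1)
      coord.span_minimal[of T H] by auto
qed

section \<open>Algebra of alternating maps\<close>

lemma alternating_mapsD:
  assumes "B \<in> alternating_maps s N" "x \<in> coord_space N" "y \<in> coord_space N" "z \<in> coord_space N"
  shows alternating_add_left: "B (x + y) z = B x z + B y z"
    and alternating_add_right: "B z (x + y) = B z x + B z y"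
    and alternating_scale_left: "B (coord_scale c x) y = s c (B x y)"
    and alternating_scale_right: "B x (coord_scale c y) = s c (B x y)"
    and alternating_self: "B x x = 0"
  using assms unfolding alternating_maps_def by blast+

lemma alternating_diff:
  assumes B: "B \<in> alternating_maps s N" and xyz: "x \<in> coord_space N" "y \<in> coord_space N" "z \<in> coord_space N"
  shows alternating_diff_left: "B (x - y) z = B x z - B y z"
    and alternating_diff_right: "B z (x - y) = B z x - B z y"
proof -
  have d: "x - y \<in> coord_space N" using coord.subspace_diff[OF subspace_coord_space] xyz by blast
  show "B (x - y) z = B x z - B y z" "B z (x - y) = B z x - B z y"
    using alternating_add_left[OF B d xyz(2,3)] alternating_add_right[OF B d xyz(2,3)] by simp_all
qed

lemma alternating_skew:
  assumes B: "B \<in> alternating_maps s N" and xy: "x \<in> coord_space N" "y \<in> coord_space N"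
  shows "B x y = - B y x"
proof -
  have a: "x + y \<in> coord_space N" using coord.subspace_add[OF subspace_coord_space] xy by blast
  have "0 = B (x + y) (x + y)" using alternating_self[OF B a a a] by simp
  also have "\<dots> = B x y + B y x"
    using alternating_add_left[OF B xy a] alternating_add_right[OF B xy xy(1)]
      alternating_add_right[OF B xy xy(2)] alternating_self[OF B xy xy(1)]
      alternating_self[OF B xy(2,1) xy(1)] by simp
  finally show ?thesis by (simp add: eq_neg_iff_add_eq_0)
qed

lemma subspace_annihilator:
  assumes B: "B \<in> alternating_maps s N" and s: "vector_space s" and T: "T \<subseteq> coord_space N"
  shows "coord.subspace {x \<in> coord_space N. \<forall>y\<in>T. B x y = 0}"
proof -
  interpret w: vector_space s by (rule s)
  note V = subspace_coord_space[of N, where 'a = 'a]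
  have "B 0 y = 0" if "y \<in> T" for y
    using alternating_diff_left[OF B coord.subspace_0[OF V] coord.subspace_0[OF V], of y] that T by auto
  then show ?thesis
    unfolding coord.subspace_def
    using coord.subspace_0[OF V] coord.subspace_add[OF V] coord.subspace_scale[OF V]
      alternating_add_left[OF B] alternating_scale_left[OF B] T
    by (auto simp: subset_iff)
qed

text \<open>Annihilators are subspaces in the left argument; skew symmetry carries the same argument
  over to the right one.\<close>

lemma alternating_vanish_span:
  assumes B: "B \<in> alternating_maps s N" and s: "vector_space s"
    and S: "S \<subseteq> coord_space N" and T: "T \<subseteq> coord_space N"
    and ST: "\<And>x y. x \<in> S \<Longrightarrow> y \<in> T \<Longrightarrow> B x y = 0"
    and x: "x \<in> coord.span S" and y: "y \<in> coord.span T"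
  shows "B x y = 0"
proof -
  have spS: "coord.span S \<subseteq> coord_space N"
    using coord.span_minimal[OF S subspace_coord_space] .
  have "coord.span S \<subseteq> {x \<in> coord_space N. \<forall>y\<in>T. B x y = 0}"
    using S ST by (intro coord.span_minimal subspace_annihilator[OF B s T]) auto
  then have 1: "B x b = 0" if "b \<in> T" for b using x that by auto
  have "coord.span T \<subseteq> {y \<in> coord_space N. \<forall>x\<in>coord.span S. B y x = 0}"
  proof (intro coord.span_minimal subspace_annihilator[OF B s spS], clarify, intro conjI ballI)
    fix b x assume b: "b \<in> T" and x: "x \<in> coord.span S"
    have "B x b = 0"
      using \<open>coord.span S \<subseteq> {x \<in> coord_space N. \<forall>y\<in>T. B x y = 0}\<close> x b by auto
    then show "B b x = 0" using alternating_skew[OF B, of b x] b T x spS by auto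
  qed (use T in auto)
  then have "B y x = 0" and "y \<in> coord_space N" using x y by auto
  then show ?thesis using alternating_skew[OF B, of x y] x spS by auto
qed

lemma alternating_maps_diff:
  assumes s: "vector_space s" and "A \<in> alternating_maps s N" "B \<in> alternating_maps s N"
  shows "A - B \<in> alternating_maps s N"
proof -
  interpret w: vector_space s by (rule s)
  show ?thesis
    using assms(2,3) unfolding alternating_maps_def by (auto simp: w.scale_right_diff_distrib)
qed

text \<open>The bilinear map with prescribed values on \<open>P\<close> is the combination of the wedge products
  \<open>u\<^sub>a \<and> u\<^sub>b\<close> of the functionals dual to \<open>S\<close>.\<close>

lemma alternating_map_exists:
  fixes w :: "(nat \<Rightarrow> 'a::field) \<times> (nat \<Rightarrow> 'a) \<Rightarrow> 'w::ab_group_add"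
  assumes s: "vector_space s" and S: "\<not> coord.dependent S" "S \<subseteq> coord_space N"
    and P: "finite P" "P \<subseteq> S \<times> S" "\<And>a b. (a, b) \<in> P \<Longrightarrow> (b, a) \<notin> P"
  obtains B where "B \<in> alternating_maps s N" "\<And>a b. (a, b) \<in> P \<Longrightarrow> B a b = w (a, b)"
proof -
  interpret w: vector_space s by (rule s)
  let ?E = "coord.extend_basis S"
  note E = coord.independent_extend_basis[OF S(1)] coord.span_extend_basis[OF S(1)]
    coord.extend_basis_superset[OF S(1)]
  define u where "u = (\<lambda>a x. coord.representation ?E x a)"
  have u_add: "u a (x + y) = u a x + u a y" for a x y
    using coord.representation_add[OF E(1)] E(2) by (simp add: u_def)
  have u_scale: "u a (coord_scale c x) = c * u a x" for a c x
    using coord.representation_scale[OF E(1)] E(2) by (simp add: u_def)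
  have u_dual: "u a b = (if a = b then 1 else 0)" if "b \<in> S" for a b
    using coord.representation_basis[OF E(1), of b] that E(3) by (auto simp: u_def)
  define B where "B = (\<lambda>x y. if x \<in> coord_space N \<and> y \<in> coord_space N
    then \<Sum>(a, b)\<in>P. s (u a x * u b y - u b x * u a y) (w (a, b)) else 0)"
  note V = coord.subspace_add[OF subspace_coord_space] coord.subspace_scale[OF subspace_coord_space]
  have "B \<in> alternating_maps s N"
    unfolding alternating_maps_def B_def
    by (auto simp: V u_add u_scale w.scale_sum_right split_def algebra_simps w.scale_left_distrib
        w.scale_left_diff_distrib simp flip: sum.distrib intro!: sum.cong)
  moreover have "B a b = w (a, b)" if ab: "(a, b) \<in> P" for a b
  proof -
    have mem: "a \<in> S" "b \<in> S" "a \<in> coord_space N" "b \<in> coord_space N" using ab P(2) S(2) by auto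
    have "a \<noteq> b" using ab P(3) by auto
    have "B a b = (\<Sum>p\<in>P. if p = (a, b) then w (a, b) else 0)"
      unfolding B_def using mem ab P(3) \<open>a \<noteq> b\<close>
      by (auto simp: u_dual split_def intro!: sum.cong)
    then show ?thesis using ab P(1) by simp
  qed
  ultimately show thesis using that by blast
qed

text \<open>Evaluation on \<open>P\<close> is a homomorphism, and
  \<open>alternating_map_exists\<close> makes it surjective. Hence the values of a uniform map on
  the pairs in \<open>P\<close> are independent and uniform.\<close>

lemma card_alternating_vanishing:
  fixes s :: "'a::{field,finite} \<Rightarrow> 'w::{ab_group_add,finite} \<Rightarrow> 'w"
  assumes s: "vector_space s" and S: "\<not> coord.dependent S" "S \<subseteq> coord_space N"
    and P: "finite P" "P \<subseteq> S \<times> S" "\<And>a b. (a, b) \<in> P \<Longrightarrow> (b, a) \<notin> P"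
  shows "card (alternating_maps s N) =
    card {B \<in> alternating_maps s N. \<forall>(a, b)\<in>P. B a b = 0} * CARD('w) ^ card P"
proof -
  let ?A = "alternating_maps s N"
  define f where "f = (\<lambda>(B :: (nat \<Rightarrow> 'a) \<Rightarrow> (nat \<Rightarrow> 'a) \<Rightarrow> 'w) p. if p \<in> P then B (fst p) (snd p) else 0)"
  have "card ?A = card {B \<in> ?A. f B = 0} * card (f ` ?A)"
    by (rule card_hom[OF finite_alternating_maps alternating_maps_diff[OF s]])
       (auto simp: f_def fun_eq_iff)
  moreover have "{B \<in> ?A. f B = 0} = {B \<in> ?A. \<forall>(a, b)\<in>P. B a b = 0}"
    by (auto simp: f_def fun_eq_iff)
  moreover have "f ` ?A = {h. \<forall>p. p \<notin> P \<longrightarrow> h p = 0}"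
  proof (intro equalityI subsetI)
    fix h :: "(nat \<Rightarrow> 'a) \<times> (nat \<Rightarrow> 'a) \<Rightarrow> 'w" assume h: "h \<in> {h. \<forall>p. p \<notin> P \<longrightarrow> h p = 0}"
    obtain B where B: "B \<in> ?A" "\<And>a b. (a, b) \<in> P \<Longrightarrow> B a b = h (a, b)"
      using alternating_map_exists[OF s S P] by metis
    then have "f B = h" using h by (auto simp: f_def fun_eq_iff)
    with B(1) show "h \<in> f ` ?A" by blast
  qed (auto simp: f_def)
  ultimately show ?thesis using card_supported_functions[OF P(1), where 'w = 'w] by simp
qed

text \<open>An alternating map has one free value for each unordered pair of distinct basis vectors,
  and \<open>P\<close> picks one ordering of each pair. A new element \<open>x\<close> contributes
  the pairs \<open>(x, b)\<close>, which is the recursion for \<open>choose 2\<close>.\<close>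

lemma obtain_orientation:
  assumes "finite S"
  obtains P where "P \<subseteq> S \<times> S" "\<And>a b. (a, b) \<in> P \<Longrightarrow> (b, a) \<notin> P"
    "\<And>a b. a \<in> S \<Longrightarrow> b \<in> S \<Longrightarrow> a \<noteq> b \<Longrightarrow> (a, b) \<in> P \<or> (b, a) \<in> P" "card P = card S choose 2"
  using assms
proof (induction S arbitrary: thesis rule: finite_induct)
  case (insert x S)
  obtain P where P: "P \<subseteq> S \<times> S" "\<And>a b. (a, b) \<in> P \<Longrightarrow> (b, a) \<notin> P"
    "\<And>a b. a \<in> S \<Longrightarrow> b \<in> S \<Longrightarrow> a \<noteq> b \<Longrightarrow> (a, b) \<in> P \<or> (b, a) \<in> P" "card P = card S choose 2"
    by (rule insert.IH) blast
  have "finite P" using P(1) insert.hyps by (meson finite_SigmaI finite_subset)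
  then have "card (P \<union> {x} \<times> S) = card P + card S"
    using P(1) insert.hyps by (subst card_Un_disjoint) (auto simp: card_cartesian_product_singleton)
  also have "\<dots> = card (insert x S) choose 2"
    using P(4) insert.hyps by (simp add: numeral_2_eq_2)
  finally have card: "card (P \<union> {x} \<times> S) = card (insert x S) choose 2" .
  show ?case
  proof (rule insert.prems[of "P \<union> {x} \<times> S"])
    show "(a, b) \<in> P \<union> {x} \<times> S \<or> (b, a) \<in> P \<union> {x} \<times> S"
      if "a \<in> insert x S" "b \<in> insert x S" "a \<noteq> b" for a b
      using that P(3)[of a b] by blast
    show "(b, a) \<notin> P \<union> {x} \<times> S" if "(a, b) \<in> P \<union> {x} \<times> S" for a b
      using that P(1) P(2)[of a b] insert.hyps by blast
  qed (use P(1) card in auto)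
qed auto

text \<open>Isotropy of \<open>H\<close> amounts to vanishing on an orientation of a basis of
  \<open>H\<close>, because skew symmetry and bilinearity do the rest. So \<open>H\<close> is
  isotropic with probability \<open>1 / CARD('w) ^ (r choose 2)\<close>.\<close>

lemma card_isotropic:
  fixes s :: "'a::{field,finite} \<Rightarrow> 'w::{ab_group_add,finite} \<Rightarrow> 'w"
  assumes s: "vector_space s" and H: "coord.subspace H" "H \<subseteq> coord_space N" "card H = CARD('a) ^ r"
  shows "card (alternating_maps s N) =
    card {B \<in> alternating_maps s N. totally_isotropic B H} * CARD('w) ^ (r choose 2)"
proof -
  have finH: "finite H" using H(2) finite_coord_space finite_subset by blast
  obtain S where S: "finite S" "S \<subseteq> H" "\<not> coord.dependent S" "coord.span S = H" "card H = CARD('a) ^ card S"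
    using obtain_basis[OF H(1) finH] by metis
  have r: "card S = r" using S(5) H(3) card_field_gt_1[where 'a = 'a] by simp
  obtain P where P: "P \<subseteq> S \<times> S" "\<And>a b. (a, b) \<in> P \<Longrightarrow> (b, a) \<notin> P"
    "\<And>a b. a \<in> S \<Longrightarrow> b \<in> S \<Longrightarrow> a \<noteq> b \<Longrightarrow> (a, b) \<in> P \<or> (b, a) \<in> P" "card P = card S choose 2"
    using obtain_orientation[OF S(1)] by metis
  have finP: "finite P" using P(1) S(1) by (meson finite_SigmaI finite_subset)
  have SN: "S \<subseteq> coord_space N" using S(2) H(2) by blast
  have "{B \<in> alternating_maps s N. \<forall>(a, b)\<in>P. B a b = 0} = {B \<in> alternating_maps s N. totally_isotropic B H}"
  proof (intro Collect_cong conj_cong refl iffI)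
    fix B assume B: "B \<in> alternating_maps s N" and van: "\<forall>(a, b)\<in>P. B a b = 0"
    have "B a b = 0" if ab: "a \<in> S" "b \<in> S" for a b
    proof (cases "a = b")
      case True
      then show ?thesis using alternating_self[OF B] ab SN by blast
    next
      case False
      have skew: "B a b = - B b a" using alternating_skew[OF B] ab SN by blast
      consider "(a, b) \<in> P" | "(b, a) \<in> P" using P(3)[OF ab False] by blast
      then show ?thesis using van skew by cases auto
    qed
    then show "totally_isotropic B H"
      unfolding totally_isotropic_def using alternating_vanish_span[OF B s SN SN] S(4) by auto
  qed (use P(1) S(2) in \<open>auto simp: totally_isotropic_def\<close>)
  then show ?thesis
    using card_alternating_vanishing[OF s S(3) SN finP P(1,2)] P(4) r by simp
qed

text \<open>Subtraction maps \<open>Z H \<times> Z H'\<close> into \<open>Z (H \<inter> H')\<close>,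
  so \<open>card_times_card\<close> bounds the joint count from below. This is the correlation that
  drives the second moment.\<close>

lemma card_isotropic_both:
  fixes s :: "'a::{field,finite} \<Rightarrow> 'w::{ab_group_add,finite} \<Rightarrow> 'w"
    and N :: nat
  assumes s: "vector_space s"
  defines "Z \<equiv> \<lambda>H. {B \<in> alternating_maps s N. totally_isotropic B H}"
  shows "card (Z H) * card (Z H') \<le> card (Z H \<inter> Z H') * card (Z (H \<inter> H'))"
proof -
  have fin: "finite (Z K)" for K unfolding Z_def using finite_alternating_maps[of s N] by simp
  have diff: "A - B \<in> Z K" if "A \<in> Z K" "B \<in> Z K" for A B K
    using that alternating_maps_diff[OF s] by (auto simp: Z_def totally_isotropic_def)
  have "(\<lambda>(A, B). A - B) ` (Z H \<times> Z H') \<subseteq> Z (H \<inter> H')"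
    using alternating_maps_diff[OF s] by (auto simp: Z_def totally_isotropic_def)
  then have "card ((\<lambda>(A, B). A - B) ` (Z H \<times> Z H')) \<le> card (Z (H \<inter> H'))"
    by (intro card_mono fin)
  then show ?thesis using card_times_card[OF fin fin diff diff, of H H'] by simp
qed

text \<open>A map with \<open>K\<close> in its radical vanishes on an orientation of a basis
  \<open>S\<close> of \<open>K\<close> and on all pairs from \<open>S\<close> to a complementary
  basis \<open>C\<close>. These two families of pairs give the two summands of the exponent.\<close>

lemma card_radical_contains:
  fixes s :: "'a::{field,finite} \<Rightarrow> 'w::{ab_group_add,finite} \<Rightarrow> 'w"
  assumes s: "vector_space s" and K: "coord.subspace K" "K \<subseteq> coord_space N" "card K = CARD('a) ^ d"
  shows "card {B \<in> alternating_maps s N. \<forall>x\<in>K. \<forall>y\<in>coord_space N. B x y = 0}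
      * CARD('w) ^ ((d choose 2) + d * (N - d)) \<le> card (alternating_maps s N)"
proof -
  have finK: "finite K" using K(2) finite_coord_space finite_subset by blast
  obtain S where S: "finite S" "S \<subseteq> K" "\<not> coord.dependent S" "card K = CARD('a) ^ card S"
    using obtain_basis[OF K(1) finK] by metis
  have d: "card S = d" using S(4) K(3) card_field_gt_1[where 'a = 'a] by simp
  have SN: "S \<subseteq> coord_space N" using S(2) K(2) by blast
  obtain C where C: "finite C" "C \<subseteq> coord_space N" "S \<inter> C = {}" "\<not> coord.dependent (S \<union> C)"
    "card (coord_space N :: (nat \<Rightarrow> 'a) set) = CARD('a) ^ (card S + card C)"
    using obtain_basis_extension[OF subspace_coord_space finite_coord_space SN S(3)] by metis
  have cC: "card C = N - d"
    using C(5) d card_field_gt_1[where 'a = 'a] by (simp add: card_coord_space)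
  obtain P where P: "P \<subseteq> S \<times> S" "\<And>a b. (a, b) \<in> P \<Longrightarrow> (b, a) \<notin> P" "card P = card S choose 2"
    using obtain_orientation[OF S(1)] by metis
  have finP: "finite P" using P(1) S(1) by (meson finite_SigmaI finite_subset)
  define Q where "Q = P \<union> S \<times> C"
  have "P \<inter> S \<times> C = {}" using P(1) C(3) by auto
  then have cQ: "card Q = (d choose 2) + d * (N - d)"
    using finP S(1) C(1) P(3) d cC by (simp add: Q_def card_Un_disjoint card_cartesian_product)
  have finQ: "finite Q" using finP S(1) C(1) by (simp add: Q_def)
  have "card (alternating_maps s N) =
    card {B \<in> alternating_maps s N. \<forall>(a, b)\<in>Q. B a b = 0} * CARD('w) ^ card Q"
  proof (rule card_alternating_vanishing[OF s C(4)])
    show "(b, a) \<notin> Q" if "(a, b) \<in> Q" for a b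
      using that P(1,2) C(3) unfolding Q_def by blast
  qed (use SN C P(1) finQ in \<open>auto simp: Q_def\<close>)
  moreover have "{B \<in> alternating_maps s N. \<forall>x\<in>K. \<forall>y\<in>coord_space N. B x y = 0}
      \<subseteq> {B \<in> alternating_maps s N. \<forall>(a, b)\<in>Q. B a b = 0}"
  proof (intro Collect_mono impI conjI, simp)
    fix B assume van: "B \<in> alternating_maps s N \<and> (\<forall>x\<in>K. \<forall>y\<in>coord_space N. B x y = 0)"
    have "Q \<subseteq> K \<times> coord_space N" using P(1) S(2) SN C(2) by (auto simp: Q_def)
    with van show "\<forall>(a, b)\<in>Q. B a b = 0" by blast
  qed
  then have "card {B \<in> alternating_maps s N. \<forall>x\<in>K. \<forall>y\<in>coord_space N. B x y = 0}
      \<le> card {B \<in> alternating_maps s N. \<forall>(a, b)\<in>Q. B a b = 0}"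
    by (intro card_mono) (use finite_alternating_maps[of s N] in auto)
  ultimately show ?thesis using cQ by simp
qed

section \<open>From isotropic subspaces to the radical\<close>

lemma vector_space_field: "vector_space ((*) :: 'a::field \<Rightarrow> 'a \<Rightarrow> 'a)"
  by unfold_locales (auto simp: algebra_simps)

text \<open>A vector of \<open>H\<close> orthogonal to a complementary basis \<open>C\<close> is
  orthogonal to everything, since \<open>H\<close> is isotropic. These are \<open>N - r\<close>
  conditions on \<open>H\<close>, which leave dimension at least \<open>2 * r - N\<close>.\<close>

lemma isotropic_imp_radical:
  fixes B :: "(nat \<Rightarrow> 'a::{field,finite}) \<Rightarrow> (nat \<Rightarrow> 'a) \<Rightarrow> 'a"
  assumes B: "B \<in> alternating_maps (*) N" and H: "H \<in> subspaces_of_dim N r"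
    and iso: "totally_isotropic B H" and d: "d + N \<le> 2 * r"
  obtains K where "K \<in> subspaces_of_dim N d" "\<forall>x\<in>K. \<forall>y\<in>coord_space N. B x y = 0"
proof -
  let ?q = "CARD('a)"
  note s = vector_space_field[where 'a = 'a]
  note q = card_field_gt_1[where 'a = 'a]
  have H': "coord.subspace H" "H \<subseteq> coord_space N" "card H = ?q ^ r"
    using H by (auto simp: subspaces_of_dim_alt)
  have finH: "finite H" using H'(2) finite_coord_space finite_subset by blast
  obtain S where S: "finite S" "S \<subseteq> H" "\<not> coord.dependent S" "card H = ?q ^ card S"
    using obtain_basis[OF H'(1) finH] by metis
  have r: "card S = r" using S(4) H'(3) q by simp
  have SN: "S \<subseteq> coord_space N" using S(2) H'(2) by blast
  obtain C where C: "finite C" "C \<subseteq> coord_space N" "coord.span (S \<union> C) = coord_space N"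
    "card (coord_space N :: (nat \<Rightarrow> 'a) set) = ?q ^ (card S + card C)"
    using obtain_basis_extension[OF subspace_coord_space finite_coord_space SN S(3)] by metis
  have cC: "N = r + card C"
    using C(4) r q by (simp add: card_coord_space)
  let ?K = "{x \<in> H. \<forall>c\<in>C. B x c = 0}"
  have "?K = H \<inter> {x \<in> coord_space N. \<forall>c\<in>C. B x c = 0}" using H'(2) by auto
  then have subK: "coord.subspace ?K"
    using coord.subspace_inter[OF H'(1) subspace_annihilator[OF B s C(2)]] by simp
  have "card H \<le> card ?K * ?q ^ card C"
    by (rule card_common_kernel[OF finH C(1)])
       (use H'(1,2) C(2) coord.subspace_diff alternating_diff_left[OF B] in \<open>auto simp: subset_iff\<close>)
  moreover have "?q ^ d * ?q ^ card C \<le> card H"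
    using H'(3) d cC q by (simp add: flip: power_add)
  ultimately have "?q ^ d * ?q ^ card C \<le> card ?K * ?q ^ card C" by linarith
  then have "?q ^ d \<le> card ?K" using q by simp
  then obtain K where K: "coord.subspace K" "K \<subseteq> ?K" "card K = ?q ^ d"
    using obtain_subspace_of_card[OF subK] finH by auto
  have "B x y = 0" if x: "x \<in> K" and y: "y \<in> coord_space N" for x y
  proof (rule alternating_vanish_span[OF B s])
    show "K \<subseteq> coord_space N" "S \<union> C \<subseteq> coord_space N" using K H' SN C by auto
    show "x \<in> coord.span K" using x by (rule coord.span_base)
    show "y \<in> coord.span (S \<union> C)" using y C(3) by simp
    show "B x y = 0" if "x \<in> K" "y \<in> S \<union> C" for x y
    proof -
      have "x \<in> H" "\<forall>c\<in>C. B x c = 0" using that(1) K(2) by auto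
      then show ?thesis using that(2) S(2) iso unfolding totally_isotropic_def by blast
    qed
  qed
  moreover have "K \<in> subspaces_of_dim N d"
    using K H'(2) by (auto simp: subspaces_of_dim_alt)
  ultimately show thesis using that by blast
qed

section \<open>Common isotropic subspaces of two forms\<close>

text \<open>The dimension formula in multiplicative form; replacing \<open>y\<close> by
  \<open>- y\<close> identifies the differences in \<open>card_times_card\<close> with sums.\<close>

lemma card_span_Un:
  fixes A B :: "(nat \<Rightarrow> 'a::{field,finite}) set"
  assumes A: "coord.subspace A" "finite A" and B: "coord.subspace B" "finite B"
  shows "card A * card B = card (A \<inter> B) * card (coord.span (A \<union> B))"
proof -
  have spA: "coord.span A = A" and spB: "coord.span B = B"
    using A(1) B(1) by (simp_all only: coord.span_eq_iff)
  have "(\<lambda>(x, y). x - y) ` (A \<times> B) = coord.span (A \<union> B)"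
    unfolding coord.span_Un spA spB
  proof (intro equalityI subsetI)
    fix z assume "z \<in> {x + y |x y. x \<in> A \<and> y \<in> B}"
    then obtain x y where "z = x + y" "x \<in> A" "y \<in> B" by blast
    then show "z \<in> (\<lambda>(x, y). x - y) ` (A \<times> B)"
      using coord.subspace_neg[OF B(1)] by (intro image_eqI[where x = "(x, - y)"]) auto
  next
    fix z assume "z \<in> (\<lambda>(x, y). x - y) ` (A \<times> B)"
    then obtain x y where "z = x + - y" "x \<in> A" "y \<in> B" by auto
    then show "z \<in> {x + y |x y. x \<in> A \<and> y \<in> B}"
      using coord.subspace_neg[OF B(1)] by blast
  qed
  then show ?thesis
    using card_times_card[OF A(2) B(2) coord.subspace_diff[OF A(1)] coord.subspace_diff[OF B(1)]]
    by simp
qed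

text \<open>Fraction-free elimination of a pair \<open>i, j\<close> with \<open>A i j \<noteq> 0\<close>.\<close>

lemma odd_alternating_singular:
  fixes A :: "'k \<Rightarrow> 'k \<Rightarrow> 'r::idom"
  assumes "finite S" "odd (card S)"
    and "\<And>k. k \<in> S \<Longrightarrow> A k k = 0"
    and "\<And>k l. k \<in> S \<Longrightarrow> l \<in> S \<Longrightarrow> A k l = - A l k"
  shows "\<exists>v. (\<exists>k\<in>S. v k \<noteq> 0) \<and> (\<forall>l\<in>S. (\<Sum>k\<in>S. v k * A k l) = 0)"
  using assms
proof (induction "card S" arbitrary: S A rule: less_induct)
  case less
  note alt = less.prems(3) and skew = less.prems(4)
  show ?case
  proof (cases "\<forall>i\<in>S. \<forall>j\<in>S. A i j = 0")
    case True
    \<comment> \<open>Elimination removes indices in pairs, so by parity it must stop at a nonempty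
      set on which \<open>A\<close> vanishes.\<close>
    have "S \<noteq> {}" using less.prems(2) by auto
    then show ?thesis using True by (intro exI[of _ "\<lambda>_. 1"]) auto
  next
    case False
    then obtain i j where ij: "i \<in> S" "j \<in> S" "A i j \<noteq> 0" by blast
    have "i \<noteq> j" using ij alt by auto
    define T where "T = S - {i, j}"
    have ST: "S = insert i (insert j T)" "i \<notin> T" "j \<notin> T" "finite T"
      using ij less.prems(1) by (auto simp: T_def)
    have cST: "card S = card T + 2" using ST \<open>i \<noteq> j\<close> by simp
    define p where "p = A i j"
    \<comment> \<open>The Schur complement of the block on \<open>i\<close>, \<open>j\<close>,
      multiplied by the pivot \<open>p\<close> to stay in the integral domain.\<close>
    define A' where "A' = (\<lambda>k l. p * A k l - A k j * A i l + A k i * A j l)"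
    have "\<exists>w. (\<exists>k\<in>T. w k \<noteq> 0) \<and> (\<forall>l\<in>T. (\<Sum>k\<in>T. w k * A' k l) = 0)"
    proof (rule less.hyps)
      show "A' k k = 0" if "k \<in> T" for k
        using alt[of k] skew[of i k] skew[of j k] that ij by (simp add: A'_def T_def)
      show "A' k l = - A' l k" if "k \<in> T" "l \<in> T" for k l
        using skew[of k l] skew[of i k] skew[of i l] skew[of j k] skew[of j l] that ij
        by (simp add: A'_def T_def algebra_simps)
    qed (use cST ST less.prems(2) in auto)
    then obtain w where w: "\<exists>k\<in>T. w k \<noteq> 0" "\<forall>l\<in>T. (\<Sum>k\<in>T. w k * A' k l) = 0" by blast
    \<comment> \<open>The entry at \<open>i\<close> is forced by column \<open>j\<close> and the
      entry at \<open>j\<close> by column \<open>i\<close>, once the entries of \<open>w\<close> are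
      scaled by \<open>p\<close>.\<close>
    define v where "v = (\<lambda>k. if k = i then - (\<Sum>k\<in>T. w k * A k j)
      else if k = j then (\<Sum>k\<in>T. w k * A k i) else p * w k)"
    have "(\<Sum>k\<in>S. v k * A k l) = 0" if l: "l \<in> S" for l
    proof -
      have "(\<Sum>k\<in>T. v k * A k l) = (\<Sum>k\<in>T. p * w k * A k l)"
        by (rule sum.cong) (use ST in \<open>auto simp: v_def\<close>)
      then have "(\<Sum>k\<in>S. v k * A k l) = - (\<Sum>k\<in>T. w k * A k j) * A i l
          + (\<Sum>k\<in>T. w k * A k i) * A j l + (\<Sum>k\<in>T. p * w k * A k l)"
        using ST \<open>i \<noteq> j\<close> by (simp add: v_def)
      also have "\<dots> = (\<Sum>k\<in>T. w k * A' k l)"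
        by (simp add: A'_def sum_distrib_left ring_distribs sum.distrib sum_subtractf mult_ac sum_negf)
      also have "\<dots> = 0"
      proof (cases "l \<in> T")
        case False
        then have "l = i \<or> l = j" using l ST by auto
        then have "A' k l = 0" for k
          using alt[of i] alt[of j] skew[of j i] ij by (auto simp: A'_def p_def algebra_simps)
        then show ?thesis by simp
      qed (use w in blast)
      finally show ?thesis .
    qed
    moreover have "\<exists>k\<in>S. v k \<noteq> 0"
    proof -
      obtain k where k: "k \<in> T" "w k \<noteq> 0" using w by blast
      then have "v k = p * w k" using ST by (auto simp: v_def)
      then show ?thesis using k ij(3) ST(1) by (intro bexI[of _ k]) (auto simp: p_def)
    qed
    ultimately show ?thesis by blast
  qed
qed

lemma alternating_sum_left:
  fixes B :: "(nat \<Rightarrow> 'a::field) \<Rightarrow> (nat \<Rightarrow> 'a) \<Rightarrow> 'a"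
  assumes B: "B \<in> alternating_maps (*) N" and y: "y \<in> coord_space N"
    and S: "finite S" "S \<subseteq> coord_space N"
  shows "B (\<Sum>k\<in>S. coord_scale (c k) k) y = (\<Sum>k\<in>S. c k * B k y)"
  using S
proof (induction S rule: finite_induct)
  case empty
  have z: "0 \<in> coord_space N" by (rule coord.subspace_0[OF subspace_coord_space])
  show ?case using alternating_diff_left[OF B z z y] by (simp add: zero_fun_def)
next
  case (insert k S)
  have "coord_scale (c k) k \<in> coord_space N"
    using insert.prems coord.subspace_scale[OF subspace_coord_space] by auto
  moreover have "(\<Sum>k\<in>S. coord_scale (c k) k) \<in> coord_space N"
    using insert.prems coord.subspace_scale[OF subspace_coord_space]
    by (intro coord.subspace_sum[OF subspace_coord_space]) auto
  ultimately have "B (coord_scale (c k) k + (\<Sum>k\<in>S. coord_scale (c k) k)) y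
      = c k * B k y + (\<Sum>k\<in>S. c k * B k y)"
    using insert.IH insert.prems alternating_add_left[OF B _ _ y]
      alternating_scale_left[OF B _ y y, of k] by simp
  then show ?case unfolding sum.insert[OF insert.hyps] .
qed

text \<open>A polynomial kernel vector \<open>\<Sum>\<^sub>m w\<^sub>m t\<^sup>m\<close> of the pencil \<open>B1 + t B2\<close>, which exists in odd
  dimension. The vanishing \<open>B1 w\<^sub>0\<close> and the recursion \<open>B1 w\<^sub>m\<^sub>+\<^sub>1 = - B2 w\<^sub>m\<close> are its coefficients.\<close>

lemma pencil_kernel:
  fixes V :: "(nat \<Rightarrow> 'a::{field,finite}) set"
  assumes B: "B1 \<in> alternating_maps (*) N" "B2 \<in> alternating_maps (*) N"
    and V: "coord.subspace V" "V \<subseteq> coord_space N" "card V = CARD('a) ^ (2 * n + 1)"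
  obtains w :: "nat \<Rightarrow> nat \<Rightarrow> 'a" where "\<And>m. w m \<in> V" "\<exists>m. w m \<noteq> 0"
    "\<And>y. y \<in> V \<Longrightarrow> B1 (w 0) y = 0"
    "\<And>m y. y \<in> V \<Longrightarrow> B1 (w (Suc m)) y = - B2 (w m) y"
proof -
  have finV: "finite V" using V(2) finite_coord_space finite_subset by blast
  obtain S where S: "finite S" "S \<subseteq> V" "\<not> coord.dependent S" "coord.span S = V"
    "card V = CARD('a) ^ card S"
    using obtain_basis[OF V(1) finV] by metis
  have "card S = 2 * n + 1"
    using S(5) V(3) power_inject_exp[OF card_field_gt_1[where 'a = 'a]] by metis
  then have odd: "odd (card S)" by simp
  have SN: "S \<subseteq> coord_space N" using S(2) V(2) by blast
  \<comment> \<open>The linear polynomials \<open>[:B1 k l, B2 k l:]\<close> form the Gram matrix of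
    the pencil, and the polynomial ring is an integral domain.\<close>
  have "\<exists>v. (\<exists>k\<in>S. v k \<noteq> 0) \<and> (\<forall>l\<in>S. (\<Sum>k\<in>S. v k * [:B1 k l, B2 k l:]) = 0)"
  proof (rule odd_alternating_singular[OF S(1) odd])
    show "[:B1 k k, B2 k k:] = 0" if "k \<in> S" for k
      using that SN alternating_self[OF B(1)] alternating_self[OF B(2)] by (auto simp: subset_iff)
    show "[:B1 k l, B2 k l:] = - [:B1 l k, B2 l k:]" if "k \<in> S" "l \<in> S" for k l
      using that SN alternating_skew[OF B(1), of k l] alternating_skew[OF B(2), of k l]
      by (auto simp: subset_iff)
  qed
  then obtain v where v: "\<exists>k\<in>S. v k \<noteq> 0" "\<And>l. l \<in> S \<Longrightarrow> (\<Sum>k\<in>S. v k * [:B1 k l, B2 k l:]) = 0"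
    by blast
  define w where "w = (\<lambda>m. \<Sum>k\<in>S. coord_scale (coeff (v k) m) k)"
  have wV: "w m \<in> V" for m
    unfolding w_def using S(2) coord.subspace_scale[OF V(1)]
    by (intro coord.subspace_sum[OF V(1)]) auto
  have wN: "w m \<in> coord_space N" for m using wV V(2) by blast
  have zN: "0 \<in> coord_space N" by (rule coord.subspace_0[OF subspace_coord_space])
  have z: "B2 0 y = 0" if "y \<in> coord_space N" for y
    using alternating_diff_left[OF B(2) zN zN that] by simp
  have Bw: "B1 (w m) l = (\<Sum>k\<in>S. coeff (v k) m * B1 k l)"
    "B2 (w m) l = (\<Sum>k\<in>S. coeff (v k) m * B2 k l)" if "l \<in> S" for m l
    unfolding w_def using that SN S(1) alternating_sum_left[OF B(1)] alternating_sum_left[OF B(2)]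
    by (auto simp: subset_iff)
  \<comment> \<open>Extends an identity from the basis \<open>S\<close> to \<open>V\<close>. Two
    separate vectors are allowed so that it covers the constant coefficient, with
    \<open>x' = 0\<close>, as well as the higher ones.\<close>
  have rec: "B1 x y + B2 x' y = 0"
    if "\<And>y. y \<in> S \<Longrightarrow> B1 x y + B2 x' y = 0" "y \<in> V" "x \<in> coord_space N" "x' \<in> coord_space N" for x x' y
  proof -
    have "coord.subspace {y \<in> coord_space N. B1 x y + B2 x' y = 0}"
      unfolding coord.subspace_def
    proof (intro conjI ballI allI; clarsimp)
      show "0 \<in> coord_space N \<and> B1 x 0 + B2 x' 0 = 0"
        using zN alternating_diff_right[OF B(1) zN zN that(3)] alternating_diff_right[OF B(2) zN zN that(4)]
        by simp
    next
      fix y z assume "y \<in> coord_space N" "z \<in> coord_space N"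
        "B1 x y + B2 x' y = 0" "B1 x z + B2 x' z = 0"
      then show "y + z \<in> coord_space N \<and> B1 x (y + z) + B2 x' (y + z) = 0"
        using alternating_add_right[OF B(1) _ _ that(3), of y z] alternating_add_right[OF B(2) _ _ that(4), of y z]
          coord.subspace_add[OF subspace_coord_space, of y N z]
        by (simp add: algebra_simps)
    next
      fix c y assume "y \<in> coord_space N" "B1 x y + B2 x' y = 0"
      then show "coord_scale c y \<in> coord_space N \<and> B1 x (coord_scale c y) + B2 x' (coord_scale c y) = 0"
        using alternating_scale_right[OF B(1) that(3) _ that(3), of y c]
          alternating_scale_right[OF B(2) that(4) _ that(4), of y c]
          coord.subspace_scale[OF subspace_coord_space, of y N c]
        by (simp flip: distrib_left)
    qed
    then have "coord.span S \<subseteq> {y \<in> coord_space N. B1 x y + B2 x' y = 0}"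
      using that(1) SN by (intro coord.span_minimal) auto
    then show ?thesis using that(2) S(4) by blast
  qed
  have "B1 (w 0) y = 0" if y: "y \<in> V" for y
  proof -
    have "B1 (w 0) l + B2 0 l = 0" if l: "l \<in> S" for l
    proof -
      have "coeff (\<Sum>k\<in>S. v k * [:B1 k l, B2 k l:]) 0 = 0" using v(2)[OF l] by simp
      then show ?thesis using Bw(1)[OF l] z l SN by (simp add: coeff_sum mult_ac subset_iff)
    qed
    then have "B1 (w 0) y + B2 0 y = 0" using y wN zN by (rule rec)
    then show ?thesis using z[of y] y V(2) by auto
  qed
  moreover have "B1 (w (Suc m)) y = - B2 (w m) y" if y: "y \<in> V" for m y
  proof -
    have "B1 (w (Suc m)) l + B2 (w m) l = 0" if l: "l \<in> S" for l
    proof -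
      have "coeff (\<Sum>k\<in>S. v k * [:B1 k l, B2 k l:]) (Suc m) = 0" using v(2)[OF l] by simp
      then show ?thesis using Bw[OF l] by (simp add: coeff_sum mult_ac sum.distrib)
    qed
    then have "B1 (w (Suc m)) y + B2 (w m) y = 0" using y wN wN by (rule rec)
    then show ?thesis by (simp add: eq_neg_iff_add_eq_0)
  qed
  moreover have "\<exists>m. w m \<noteq> 0"
  proof -
    obtain k where k: "k \<in> S" "v k \<noteq> 0" using v(1) by blast
    then obtain m where "coeff (v k) m \<noteq> 0" using leading_coeff_0_iff by blast
    then have "w m \<noteq> 0"
      unfolding w_def using coord.independentD[OF S(3) S(1) order.refl _ k(1)] by metis
    then show ?thesis ..
  qed
  ultimately show thesis using that[of w] wV by blast
qed

text \<open>Modulo the span \<open>L\<close> of the coefficients of a kernel vector of the pencil, which is isotropic,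
  the dimension drops by at most \<open>2 dim L - 1\<close> when passing to a complement of \<open>L\<close> in its common
  orthogonal space, because \<open>B1\<close> kills a nonzero vector of \<open>L\<close> and \<open>B2 L \<subseteq> B1 L\<close>.\<close>

lemma common_isotropic_exists:
  fixes V :: "(nat \<Rightarrow> 'a::{field,finite}) set"
  assumes B: "B1 \<in> alternating_maps (*) N" "B2 \<in> alternating_maps (*) N"
    and V: "coord.subspace V" "V \<subseteq> coord_space N" "card V = CARD('a) ^ (2 * n + 1)"
  shows "\<exists>H. coord.subspace H \<and> H \<subseteq> V \<and> card H = CARD('a) ^ (n + 1) \<and>
    totally_isotropic B1 H \<and> totally_isotropic B2 H"
  using V
proof (induction n arbitrary: V rule: less_induct)
  case (less n V)
  note V = less.prems
  let ?q = "CARD('a)"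
  note q = card_field_gt_1[where 'a = 'a]
  note s = vector_space_field[where 'a = 'a]
  have fin: "finite X" if "X \<subseteq> coord_space N" for X :: "(nat \<Rightarrow> 'a) set"
    using that finite_coord_space finite_subset by blast
  obtain w where w: "\<And>m. w m \<in> V" "\<exists>m. w m \<noteq> 0" "\<And>y. y \<in> V \<Longrightarrow> B1 (w 0) y = 0"
    "\<And>m y. y \<in> V \<Longrightarrow> B1 (w (Suc m)) y = - B2 (w m) y"
    using pencil_kernel[OF B V] by metis
  have wN: "w m \<in> coord_space N" for m using w(1) V(2) by blast
  define L where "L = coord.span (range w)"
  have LV: "L \<subseteq> V" unfolding L_def using w(1) by (intro coord.span_minimal[OF _ V(1)]) auto
  have subL: "coord.subspace L" by (simp add: L_def)
  have wL: "w m \<in> L" for m unfolding L_def by (intro coord.span_base) auto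
  \<comment> \<open>The recursion and skew symmetry shift one index from left to right, so that
    \<open>B1 (w (Suc i)) (w j) = B1 (w i) (w (Suc j))\<close>. After finitely many shifts the left
    vector is \<open>w 0\<close>, which \<open>B1\<close> kills.\<close>
  have B1w: "B1 (w i) (w j) = 0" for i j
  proof (induction i arbitrary: j)
    case (Suc i)
    have "B1 (w (Suc i)) (w j) = - B2 (w i) (w j)" by (rule w(4)[OF w(1)])
    also have "\<dots> = B2 (w j) (w i)" by (simp only: alternating_skew[OF B(2) wN wN, of i j] minus_minus)
    also have "\<dots> = - B1 (w (Suc j)) (w i)" using w(4)[OF w(1), of j i] by simp
    also have "\<dots> = B1 (w i) (w (Suc j))" by (simp only: alternating_skew[OF B(1) wN wN, of i "Suc j"])
    finally show ?case using Suc.IH by simp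
  qed (rule w(3)[OF w(1)])
  have B2w: "B2 (w i) (w j) = 0" for i j using w(4)[OF w(1), of i j] B1w by simp
  have Liso: "B x y = 0" if "B \<in> {B1, B2}" "x \<in> L" "y \<in> L" for B x y
  proof (rule alternating_vanish_span[where S = "range w" and T = "range w" and B = B, OF _ s])
    show "B \<in> alternating_maps (*) N" using that(1) B by auto
    show "B a b = 0" if "a \<in> range w" "b \<in> range w" for a b
      using that \<open>B \<in> {B1, B2}\<close> B1w B2w by auto
  qed (use wN that(2,3) in \<open>auto simp: L_def\<close>)
  \<comment> \<open>The first nonzero coefficient: either \<open>m = 0\<close> or its predecessor
    vanishes, so \<open>B1 (w m)\<close> is zero on \<open>V\<close> in both cases. This saves one
    orthogonality condition.\<close>
  define m where "m = (LEAST m. w m \<noteq> 0)"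
  have m: "w m \<noteq> 0" unfolding m_def using w(2) by (rule LeastI_ex)
  have B1m: "B1 (w m) y = 0" if y: "y \<in> V" for y
  proof (cases m)
    case (Suc i)
    have "w i = 0" using not_less_Least[of i "\<lambda>m. w m \<noteq> 0"] Suc m_def by simp
    have zN: "0 \<in> coord_space N" by (rule coord.subspace_0[OF subspace_coord_space])
    have yN: "y \<in> coord_space N" using y V(2) by blast
    have "B2 (w i) y = 0"
      using alternating_diff_left[OF B(2) zN zN yN] \<open>w i = 0\<close> by simp
    then show ?thesis using w(4)[OF y, of i] Suc by simp
  qed (use w(3)[OF y] in simp)
  have finL: "finite L" using fin LV V(2) by blast
  have wmL: "{w m} \<subseteq> L" using wL by blast
  have ind: "\<not> coord.dependent {w m}" using m by (simp only: coord.dependent_single not_False_eq_True)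
  obtain C where C: "finite C" "C \<subseteq> L" "coord.span ({w m} \<union> C) = L" "card L = ?q ^ (card {w m} + card C)"
    using obtain_basis_extension[OF subL finL wmL ind] by metis
  define c where "c = card C"
  have cL: "card L = ?q ^ (c + 1)" using C(4) by (simp add: c_def)
  have CN: "C \<subseteq> coord_space N" using C(2) LV V(2) by blast
  \<comment> \<open>The part of \<open>V\<close> orthogonal to \<open>L\<close> under both forms,
    although only \<open>c = dim L - 1\<close> conditions are imposed: \<open>w m\<close> gives none
    for \<open>B1\<close>, and those for \<open>B2\<close> follow through the recursion.\<close>
  define P where "P = {x \<in> V. \<forall>y\<in>C. B1 x y = 0}"
  have finP: "finite P" "P \<subseteq> coord_space N" using fin V(2) by (auto simp: P_def)
  have "P = V \<inter> {x \<in> coord_space N. \<forall>y\<in>C. B1 x y = 0}" using V(2) by (auto simp: P_def)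
  then have subP: "coord.subspace P"
    using coord.subspace_inter[OF V(1) subspace_annihilator[OF B(1) s CN]] by simp
  have "card V \<le> card {x \<in> V. \<forall>y\<in>C. B1 x y = 0} * ?q ^ card C"
    by (rule card_common_kernel[OF fin[OF V(2)] C(1)])
       (use V(1,2) CN coord.subspace_diff alternating_diff_left[OF B(1)] in \<open>auto simp: subset_iff\<close>)
  then have cP: "?q ^ (2 * n + 1) \<le> card P * ?q ^ c" using V(3) by (simp add: P_def c_def)
  have "B1 y x = 0" if "y \<in> L" "x \<in> P" for x y
  proof (rule alternating_vanish_span[OF B(1) s])
    show "{w m} \<union> C \<subseteq> coord_space N" using wN CN by auto
    show "B1 a b = 0" if "a \<in> {w m} \<union> C" "b \<in> P" for a b
    proof (cases "a \<in> C")
      case True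
      then show ?thesis using that alternating_skew[OF B(1), of a b] CN finP(2) by (auto simp: P_def)
    next
      case False
      then show ?thesis using that B1m by (auto simp: P_def)
    qed
    show "x \<in> coord.span P" using that(2) by (rule coord.span_base)
  qed (use that C(3) finP in auto)
  note B1P = this
  have "B2 y x = 0" if "y \<in> L" "x \<in> P" for x y
  proof (rule alternating_vanish_span[OF B(2) s])
    show "B2 a b = 0" if "a \<in> range w" "b \<in> P" for a b
      using that w(4) B1P wL unfolding P_def by fastforce
    show "x \<in> coord.span P" using that(2) by (rule coord.span_base)
    show "y \<in> coord.span (range w)" using that(1) by (simp add: L_def)
  qed (use wN finP in auto)
  with B1P have LP: "B y x = 0" if "B \<in> {B1, B2}" "y \<in> L" "x \<in> P" for B x y
    using that by blast
  have "L \<subseteq> P" using Liso C(2) LV unfolding P_def by blast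
  show ?case
  proof (cases "n \<le> c")
    case True
    then have "?q ^ (n + 1) \<le> card L" using cL q by simp
    then obtain H where H: "coord.subspace H" "H \<subseteq> L" "card H = ?q ^ (n + 1)"
      using obtain_subspace_of_card[OF subL finL] by metis
    have "totally_isotropic B1 H" "totally_isotropic B2 H"
      using Liso[of B1] Liso[of B2] H(2) unfolding totally_isotropic_def by blast+
    then show ?thesis using H LV by blast
  next
    case False
    then have cn: "c < n" by simp
    obtain T where T: "finite T" "T \<subseteq> L" "\<not> coord.dependent T" "coord.span T = L" "card L = ?q ^ card T"
      using obtain_basis[OF subL finL] by metis
    have cT: "card T = c + 1" using T(5) cL power_inject_exp[OF q] by metis
    obtain D where D: "finite D" "D \<subseteq> P" "T \<inter> D = {}" "\<not> coord.dependent (T \<union> D)"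
      "card P = ?q ^ (card T + card D)"
      using obtain_basis_extension[OF subP finP(1) _ T(3)] T(2) \<open>L \<subseteq> P\<close> by (metis order.trans)
    have "?q ^ (2 * n + 1) \<le> ?q ^ (c + 1 + card D + c)"
      using cP D(5) cT by (simp add: power_add)
    then have "2 * n + 1 \<le> c + 1 + card D + c" using q by (metis power_increasing_iff)
    \<comment> \<open>The complement has dimension at least \<open>2 * (n - c)\<close>. One
      dimension is given up so that \<open>M\<close> has odd dimension, as the induction hypothesis
      requires.\<close>
    then have "2 * (n - c - 1) + 1 \<le> card D" using cn by simp
    then obtain E where E: "E \<subseteq> D" "card E = 2 * (n - c - 1) + 1" "finite E"
      by (rule obtain_subset_with_card_n)
    define M where "M = coord.span E"
    have "\<not> coord.dependent E" using D(4) E(1) coord.independent_mono by blast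
    then have M: "coord.subspace M" "card M = ?q ^ (2 * (n - c - 1) + 1)"
      using finite_card_span_independent[OF E(3)] E(2) by (simp_all add: M_def)
    have MP: "M \<subseteq> P" unfolding M_def using E(1) D(2) by (intro coord.span_minimal[OF _ subP]) auto
    have MN: "M \<subseteq> coord_space N" using MP finP(2) by blast
    have "\<exists>H. coord.subspace H \<and> H \<subseteq> M \<and> card H = ?q ^ (n - c - 1 + 1) \<and>
        totally_isotropic B1 H \<and> totally_isotropic B2 H"
      by (rule less.IH[OF _ M(1) MN M(2)]) (use cn in simp)
    moreover have "n - c - 1 + 1 = n - c" using cn by simp
    ultimately obtain H where H: "coord.subspace H" "H \<subseteq> M" "card H = ?q ^ (n - c)"
      "totally_isotropic B1 H" "totally_isotropic B2 H"
      by metis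
    have finM: "finite M" and finH: "finite H" using fin MN H(2) by blast+
    \<comment> \<open>Since \<open>T \<union> E\<close> is independent, \<open>L\<close> meets
      \<open>M\<close> only in \<open>0\<close>, so the dimensions \<open>c + 1\<close> of
      \<open>L\<close> and \<open>n - c\<close> of \<open>H\<close> add up to
      \<open>n + 1\<close>.\<close>
    have TE: "coord.span (T \<union> E) = coord.span (L \<union> M)"
      unfolding coord.span_Un by (simp only: T(4) M_def L_def coord.span_span)
    have "\<not> coord.dependent (T \<union> E)"
      using D(4) E(1) coord.independent_mono[of "T \<union> D" "T \<union> E"] by blast
    then have "card (coord.span (T \<union> E)) = ?q ^ card (T \<union> E)"
      using finite_card_span_independent[of "T \<union> E"] T(1) E(3) by blast
    moreover have "card (T \<union> E) = c + 1 + card E"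
      using cT T(1) E D(3) by (subst card_Un_disjoint) auto
    ultimately have LM: "card (coord.span (L \<union> M)) = card L * card M"
      using TE cL M(2) E(2) by (simp add: power_add)
    have "card L * card M \<noteq> 0" using cL M(2) q by simp
    moreover have "1 * (card L * card M) = card (L \<inter> M) * (card L * card M)"
      using card_span_Un[OF subL finL M(1) finM] unfolding LM by (simp only: mult_1)
    ultimately have "card (L \<inter> M) = 1" using mult_right_cancel by metis
    moreover have "0 \<in> L \<inter> M" using coord.subspace_0 subL M(1) by blast
    ultimately have "L \<inter> M = {0}" by (metis card_1_singletonE singletonD)
    then have "L \<inter> H = {0}" using H(1,2) subL coord.subspace_0 by blast
    then have "card (coord.span (L \<union> H)) = ?q ^ (c + 1) * ?q ^ (n - c)"
      using card_span_Un[OF subL finL H(1) finH] cL H(3) by simp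
    then have "card (coord.span (L \<union> H)) = ?q ^ (n + 1)"
      using cn by (simp flip: power_add)
    moreover have LHN: "L \<union> H \<subseteq> coord_space N" using LV V(2) H(2) MN by blast
    have LH: "B x y = 0" if BB: "B \<in> {B1, B2}" and xy: "x \<in> L \<union> H" "y \<in> L \<union> H" for B x y
    proof -
      have BN: "B \<in> alternating_maps (*) N" using BB B by auto
      have skew: "B x y = - B y x" using alternating_skew[OF BN] xy LHN by blast
      have HP: "H \<subseteq> P" using H(2) MP by blast
      consider "x \<in> L" "y \<in> P" | "x \<in> P" "y \<in> L" | "x \<in> H" "y \<in> H"
        using xy HP \<open>L \<subseteq> P\<close> by blast
      then show ?thesis
      proof cases
        case 3
        then show ?thesis using H(4,5) BB unfolding totally_isotropic_def by blast
      qed (use LP[OF BB] skew in auto)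
    qed
    have "totally_isotropic B (coord.span (L \<union> H))" if "B \<in> {B1, B2}" for B
    proof -
      have BN: "B \<in> alternating_maps (*) N" using that B by auto
      show ?thesis unfolding totally_isotropic_def
        using alternating_vanish_span[OF BN s LHN LHN LH[OF that]] by blast
    qed
    moreover have "coord.span (L \<union> H) \<subseteq> V"
      using LV H(2) MP by (intro coord.span_minimal[OF _ V(1)]) (auto simp: P_def)
    ultimately show ?thesis by (intro exI[of _ "coord.span (L \<union> H)"]) auto
  qed
qed

section \<open>Moments\<close>

text \<open>Pairs \<open>(vs, ws)\<close> are counted twice: \<open>vs\<close> spans a
  \<open>k\<close>-dimensional part of \<open>H\<close>, and \<open>ws\<close>, independent modulo
  \<open>H\<close>, completes it to a space meeting \<open>H\<close> in that part only. A given
  space arises from at most \<open>?F\<close> pairs, namely from frames inside it.\<close>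

lemma card_meeting_in_dim:
  fixes H :: "(nat \<Rightarrow> 'a::{field,finite}) set"
  assumes H: "H \<in> subspaces_of_dim (2 * r - 1) r" and k: "1 \<le> k" "k \<le> r"
  shows "CARD('a) ^ (k * (r - k) + (r - 1) * (r - k))
    \<le> card {H' \<in> subspaces_of_dim (2 * r - 1) r. card (H \<inter> H') = CARD('a) ^ k}"
proof -
  let ?q = "CARD('a)" and ?N = "2 * r - 1"
  let ?V = "coord_space ?N :: (nat \<Rightarrow> 'a) set"
  let ?M = "{H' \<in> subspaces_of_dim ?N r. card (H \<inter> H') = ?q ^ k}"
  let ?T = "frames {0} H k \<times> frames H ?V (r - k)"
  let ?g = "\<lambda>(vs, ws). coord.span (coord.span (set vs) \<union> set ws)"
  let ?F = "(\<Prod>i<k. ?q ^ k - ?q ^ i) * (\<Prod>i<r - k. ?q ^ r - ?q ^ k * ?q ^ i)"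
  note q = card_field_gt_1[where 'a = 'a]
  have H': "coord.subspace H" "H \<subseteq> ?V" "card H = ?q ^ r"
    using H by (auto simp: subspaces_of_dim_alt)
  note V = subspace_coord_space[of ?N, where 'a = 'a] finite_coord_space[of ?N, where 'a = 'a]
  have finH: "finite H" using H'(2) V(2) finite_subset by blast
  have z: "{0} \<subseteq> W" if "coord.subspace W" for W :: "(nat \<Rightarrow> 'a) set"
    using coord.subspace_0[OF that] by simp
  have fr1: "finite (frames {0} W k) \<and> card (frames {0} W k) = (\<Prod>i<k. card W - ?q ^ i)"
    if "coord.subspace W" "finite W" for W :: "(nat \<Rightarrow> 'a) set"
    using finite_card_frames[OF _ that(1) z[OF that(1)] that(2), of k] by simp
  have fr2: "finite (frames H ?V (r - k)) \<and>
      card (frames H ?V (r - k)) = (\<Prod>i<r - k. ?q ^ ?N - ?q ^ r * ?q ^ i)"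
    using finite_card_frames[OF H'(1) V(1) H'(2) V(2)] by (simp add: H'(3) card_coord_space)
  have finM: "finite ?M" by (rule finite_subset[OF _ finite_subspaces_of_dim]) auto
  have g: "?g ` ?T \<subseteq> ?M"
  proof (rule image_subsetI)
    fix t assume "t \<in> ?T"
    then obtain vs ws where t: "t = (vs, ws)" and vs: "vs \<in> frames {0} H k"
      and ws: "ws \<in> frames H ?V (r - k)" by blast
    define U where "U = coord.span (set vs)"
    have U: "coord.subspace U" "finite U" "card U = ?q ^ k"
      using finite_card_span_frame[OF _ _ vs] by (simp_all add: U_def)
    have UH: "U \<subseteq> H" unfolding U_def
      using frames_subset[OF vs] H'(1) by (rule coord.span_minimal)
    have ws': "ws \<in> frames U ?V (r - k)"
      using frames_restrict[OF ws _ UH] frames_subset[OF ws] by blast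
    define H2 where "H2 = coord.span (U \<union> set ws)"
    have H2: "coord.subspace H2" "finite H2" "card H2 = ?q ^ r" "H2 \<subseteq> ?V"
      using finite_card_span_frame[OF U(1,2) ws'] U(3) k(2)
        span_frame_subset[OF V(1) _ ws'] UH H'(2) by (auto simp: H2_def simp flip: power_add)
    \<comment> \<open>This span has dimension \<open>2 * r - k\<close>, so the dimension formula
      gives \<open>H \<inter> H2\<close> dimension \<open>k\<close>.\<close>
    have "coord.span (H \<union> H2) = coord.span (H \<union> set ws)"
    proof -
      have "H2 \<subseteq> coord.span (H \<union> set ws)"
        unfolding H2_def using UH by (intro coord.span_mono) auto
      moreover have "set ws \<subseteq> H2" unfolding H2_def using coord.span_superset by blast
      ultimately show ?thesis
        unfolding coord.span_eq using coord.span_superset[of "H \<union> set ws"] coord.span_superset[of "H \<union> H2"]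
        by blast
    qed
    then have "card H * card H2 = card (H \<inter> H2) * (?q ^ r * ?q ^ (r - k))"
      using card_span_Un[OF H'(1) finH H2(1,2)] finite_card_span_frame[OF H'(1) finH ws] H'(3) by simp
    then have "?q ^ r = card (H \<inter> H2) * ?q ^ (r - k)" using H'(3) H2(3) q by simp
    moreover have "?q ^ r = ?q ^ k * ?q ^ (r - k)" using k by (simp flip: power_add)
    ultimately have "card (H \<inter> H2) = ?q ^ k" using q by simp
    then show "?g t \<in> ?M"
      using H2 by (simp add: t U_def H2_def subspaces_of_dim_alt)
  qed
  have fib: "card {t \<in> ?T. ?g t = H2} \<le> ?F" if "H2 \<in> ?M" for H2
  proof -
    have H2: "coord.subspace H2" "H2 \<subseteq> ?V" "card H2 = ?q ^ r" "card (H \<inter> H2) = ?q ^ k"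
      using that by (auto simp: subspaces_of_dim_alt)
    have finH2: "finite H2" using H2(2) V(2) finite_subset by blast
    have sub: "coord.subspace (H \<inter> H2)" using H'(1) H2(1) by (rule coord.subspace_inter)
    have "{t \<in> ?T. ?g t = H2} \<subseteq> frames {0} (H \<inter> H2) k \<times> frames (H \<inter> H2) H2 (r - k)"
    proof
      fix t assume t: "t \<in> {t \<in> ?T. ?g t = H2}"
      obtain vs ws where tt: "t = (vs, ws)" by fastforce
      have vs: "vs \<in> frames {0} H k" and ws: "ws \<in> frames H ?V (r - k)"
        and eq: "coord.span (coord.span (set vs) \<union> set ws) = H2"
        using t by (auto simp: tt)
      have "set vs \<subseteq> H2" "set ws \<subseteq> H2"
        using coord.span_superset[of "coord.span (set vs) \<union> set ws", unfolded eq]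
          coord.span_superset[of "set vs"] by blast+
      then show "t \<in> frames {0} (H \<inter> H2) k \<times> frames (H \<inter> H2) H2 (r - k)"
        using frames_restrict[OF vs, of "H \<inter> H2" "{0}"] frames_restrict[OF ws, of H2 "H \<inter> H2"]
          frames_subset[OF vs] by (simp add: tt)
    qed
    then have "card {t \<in> ?T. ?g t = H2} \<le> card (frames {0} (H \<inter> H2) k \<times> frames (H \<inter> H2) H2 (r - k))"
      using fr1[OF sub] finite_card_frames[OF sub H2(1) _ finH2] finH by (intro card_mono) auto
    also have "\<dots> = ?F"
      using fr1[OF sub] finite_card_frames[OF sub H2(1) _ finH2, of "r - k"] finH H2(3,4)
      by (simp add: card_cartesian_product)
    finally show ?thesis .
  qed
  \<comment> \<open>The power is distributed over the factors, \<open>r - k\<close> to each of the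
    first \<open>k\<close> and \<open>r - 1\<close> to each of the last \<open>r - k\<close>, and
    compared factor by factor. The second comparison rests on \<open>1 \<le> k\<close>.\<close>
  have "?q ^ (k * (r - k) + (r - 1) * (r - k)) * ?F
      = (\<Prod>i<k. ?q ^ (r - k) * (?q ^ k - ?q ^ i)) * (\<Prod>i<r - k. ?q ^ (r - 1) * (?q ^ r - ?q ^ k * ?q ^ i))"
    by (simp add: prod.distrib power_add mult_ac flip: power_mult)
  also have "\<dots> \<le> (\<Prod>i<k. ?q ^ r - ?q ^ i) * (\<Prod>i<r - k. ?q ^ ?N - ?q ^ r * ?q ^ i)"
  proof (intro mult_le_mono prod_mono conjI le0)
    fix i
    have "?q ^ (r - k) * ?q ^ k = ?q ^ r" using k by (simp flip: power_add)
    moreover have "?q ^ i \<le> ?q ^ (r - k) * ?q ^ i" using q by simp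
    ultimately show "?q ^ (r - k) * (?q ^ k - ?q ^ i) \<le> ?q ^ r - ?q ^ i"
      by (simp add: diff_mult_distrib2 diff_le_mono2)
  next
    fix i
    have "?q ^ (r - 1) * ?q ^ r = ?q ^ ?N" using k by (simp add: mult_2 flip: power_add)
    moreover have "?q ^ r * ?q ^ i \<le> ?q ^ (r - 1) * (?q ^ k * ?q ^ i)"
      using q k by (simp flip: power_add)
    ultimately show "?q ^ (r - 1) * (?q ^ r - ?q ^ k * ?q ^ i) \<le> ?q ^ ?N - ?q ^ r * ?q ^ i"
      by (simp add: diff_mult_distrib2 diff_le_mono2)
  qed
  also have "\<dots> = card ?T"
    using fr1[OF H'(1) finH] fr2 H'(3) by (simp add: card_cartesian_product)
  also have "\<dots> = (\<Sum>H2\<in>?M. card {t \<in> ?T. ?g t = H2})"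
    by (rule card_fibres) (use g finM fr1[OF H'(1) finH] fr2 in auto)
  also have "\<dots> \<le> (\<Sum>H2\<in>?M. ?F)" by (rule sum_mono) (rule fib)
  finally have "?q ^ (k * (r - k) + (r - 1) * (r - k)) * ?F \<le> card ?M * ?F" by simp
  moreover have "?F > 0"
    using q by (auto simp: prod_pos simp flip: power_add intro!: power_strict_increasing)
  ultimately show ?thesis by simp
qed

section \<open>The constant \<open>C_const\<close> and the size of Gaussian binomials\<close>

lemma C_const_convergent:
  assumes "q > 1"
  shows "convergent_prod (\<lambda>j. inverse (1 - 1 / real q ^ Suc j))"
proof -
  have "convergent_prod (\<lambda>j. 1 - 1 / real q ^ Suc j)"
  proof (rule abs_convergent_prod_imp_convergent_prod[OF summable_imp_abs_convergent_prod])
    have "summable (\<lambda>j. (1 / real q) * (1 / real q) ^ j)"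
      using assms by (intro summable_mult summable_geometric) simp
    then show "summable (\<lambda>j. norm (1 - 1 / real q ^ Suc j - 1))"
      by (simp add: power_one_over abs_mult)
  qed
  then show ?thesis by (rule convergent_prod_inverse)
qed

lemma inverse_one_minus_ge_1:
  assumes "q > 1"
  shows "inverse (1 - 1 / real q ^ Suc j) \<ge> 1"
proof -
  have "1 < real q ^ Suc j" using assms by (intro one_less_power) auto
  then show ?thesis by (intro one_le_inverse) (auto simp: field_simps)
qed

text \<open>All factors are at least \<open>1\<close>, so the partial products increase to the
  infinite one; the empty product gives positivity.\<close>

lemma C_const_ge:
  assumes "q > 1"
  shows C_const_ge_prod: "(\<Prod>j<n. inverse (1 - 1 / real q ^ Suc j)) \<le> C_const q"
    and C_const_pos: "C_const q > 0"
proof -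
  note f = inverse_one_minus_ge_1[OF assms]
  show le: "(\<Prod>j<n. inverse (1 - 1 / real q ^ Suc j)) \<le> C_const q" for n
    unfolding C_const_def
    by (rule prod_le_prodinf[OF convergent_prod_has_prod[OF C_const_convergent[OF assms]]])
      (rule f order.trans[OF zero_le_one f])+
  show "C_const q > 0" using le[of 0] by simp
qed

lemma C_const_LIMSEQ:
  assumes "q > 1"
  shows "(\<lambda>n. \<Prod>j<n. inverse (1 - 1 / real q ^ Suc j)) \<longlonglongrightarrow> C_const q"
  unfolding C_const_def LIMSEQ_lessThan_iff_atMost
  by (rule convergent_prod_LIMSEQ[OF C_const_convergent[OF assms]])

text \<open>Pulling the leading power out of every factor leaves a numerator product below
  \<open>1\<close> and a partial product of \<open>C_const\<close>, the two pieces that the bounds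
  and the limit handle separately.\<close>

lemma card_subspaces_of_dim_real:
  assumes r: "r \<le> N"
  shows "real (card (subspaces_of_dim N r :: (nat \<Rightarrow> 'a::{field,finite}) set set)) =
    real CARD('a) ^ (r * (N - r)) * (\<Prod>i<r. 1 - 1 / real CARD('a) ^ (N - i))
      * (\<Prod>j<r. inverse (1 - 1 / real CARD('a) ^ Suc j))"
proof -
  let ?q = "real CARD('a)" and ?S = "subspaces_of_dim N r :: (nat \<Rightarrow> 'a) set set"
  have q: "?q > 1" using card_field_gt_1[where 'a = 'a] by simp
  have factor: "real (CARD('a) ^ n - CARD('a) ^ i) = ?q ^ n * (1 - 1 / ?q ^ (n - i))" if "i < n" for i n
  proof -
    have "?q ^ n = ?q ^ (n - i) * ?q ^ i" using that by (simp flip: power_add)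
    moreover have "CARD('a) ^ i \<le> CARD('a) ^ n" using that by (intro power_increasing) auto
    ultimately show ?thesis using q by (simp add: of_nat_diff field_simps)
  qed
  have "real (card ?S) * (\<Prod>i<r. real (CARD('a) ^ r - CARD('a) ^ i)) = (\<Prod>i<r. real (CARD('a) ^ N - CARD('a) ^ i))"
    using arg_cong[OF card_subspaces_of_dim[where 'a = 'a, of N r], of real] by (simp only: of_nat_mult of_nat_prod)
  also have "(\<Prod>i<r. real (CARD('a) ^ N - CARD('a) ^ i)) = (\<Prod>i<r. ?q ^ N * (1 - 1 / ?q ^ (N - i)))"
    by (rule prod.cong) (use r factor in auto)
  also have "(\<Prod>i<r. real (CARD('a) ^ r - CARD('a) ^ i)) = (\<Prod>i<r. ?q ^ r * (1 - 1 / ?q ^ (r - i)))"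
    by (rule prod.cong) (use factor in auto)
  also have "\<dots> = ?q ^ (r * r) * (\<Prod>i<r. 1 - 1 / ?q ^ (r - i))"
    by (simp add: prod.distrib power_mult)
  also have "(\<Prod>i<r. 1 - 1 / ?q ^ (r - i)) = (\<Prod>j<r. 1 - 1 / ?q ^ Suc j)"
    by (subst prod.nat_diff_reindex[symmetric]) (auto intro!: prod.cong simp: Suc_diff_Suc)
  finally have eq: "real (card ?S) * (?q ^ (r * r) * (\<Prod>j<r. 1 - 1 / ?q ^ Suc j))
      = ?q ^ (r * N) * (\<Prod>i<r. 1 - 1 / ?q ^ (N - i))"
    by (simp add: prod.distrib power_mult mult.commute)
  have split: "?q ^ (r * N) = ?q ^ (r * r) * ?q ^ (r * (N - r))"
    using r by (simp flip: power_add distrib_left)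
  have p: "(\<Prod>j<r. 1 - 1 / ?q ^ Suc j) > 0"
  proof (rule prod_pos, clarify)
    fix j
    have "1 < ?q ^ Suc j" using q by (intro one_less_power) auto
    then show "0 < 1 - 1 / ?q ^ Suc j" by (simp add: field_simps)
  qed
  have y: "?q ^ (r * r) > 0" using q by simp
  have "x = s * n * inverse p" if "x * (y * p) = t * n" "t = y * s" "p > 0" "y > 0" for x y p t n s :: real
    using that by (simp add: field_simps)
  from this[OF eq split p y] show ?thesis
    unfolding prod_inversef[unfolded o_def] .
qed

lemma card_subspaces_of_dim_le:
  assumes "r \<le> N"
  shows "real (card (subspaces_of_dim N r :: (nat \<Rightarrow> 'a::{field,finite}) set set))
    \<le> C_const CARD('a) * real CARD('a) ^ (r * (N - r))"
proof -
  let ?q = "real CARD('a)"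
  have q: "?q > 1" using card_field_gt_1[where 'a = 'a] by simp
  have le: "1 \<le> ?q ^ n" for n using q by (intro one_le_power) auto
  have "(\<Prod>i<r. 1 - 1 / ?q ^ (N - i)) \<le> 1"
    using le by (intro prod_le_1) (auto simp: field_simps)
  moreover have "(\<Prod>i<r. 1 - 1 / ?q ^ (N - i)) \<ge> 0"
    using le by (intro prod_nonneg) (auto simp: field_simps)
  ultimately have "(\<Prod>i<r. 1 - 1 / ?q ^ (N - i)) * (\<Prod>j<r. inverse (1 - 1 / ?q ^ Suc j)) \<le> 1 * C_const CARD('a)"
    using C_const_ge_prod[OF card_field_gt_1[where 'a = 'a]] C_const_pos[OF card_field_gt_1[where 'a = 'a]]
    by (intro mult_mono) (auto intro!: prod_nonneg order.trans[OF zero_le_one inverse_one_minus_ge_1[OF card_field_gt_1]]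
        simp del: inverse_eq_divide power_Suc)
  then have "?q ^ (r * (N - r)) * ((\<Prod>i<r. 1 - 1 / ?q ^ (N - i)) * (\<Prod>j<r. inverse (1 - 1 / ?q ^ Suc j)))
      \<le> ?q ^ (r * (N - r)) * C_const CARD('a)"
    using q by (intro mult_left_mono) auto
  then show ?thesis unfolding card_subspaces_of_dim_real[OF assms] by (simp add: mult_ac)
qed

section \<open>First moment and union bound\<close>

lemma double_count:
  assumes "finite A" "finite S"
  shows "(\<Sum>B\<in>A. real (card {H \<in> S. R B H})) = (\<Sum>H\<in>S. real (card {B \<in> A. R B H}))"
proof -
  have "(\<Sum>B\<in>A. real (card {H \<in> S. R B H})) = (\<Sum>B\<in>A. \<Sum>H\<in>S. if R B H then 1 else 0)"
    using assms(2) by (simp add: sum.If_cases Int_def)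
  also have "\<dots> = (\<Sum>H\<in>S. \<Sum>B\<in>A. if R B H then 1 else 0)" by (rule sum.swap)
  also have "\<dots> = (\<Sum>H\<in>S. real (card {B \<in> A. R B H}))"
    using assms(1) by (simp add: sum.If_cases Int_def)
  finally show ?thesis .
qed

lemma alternating_maps_finite_nonempty:
  fixes s :: "'a::{field,finite} \<Rightarrow> 'w::{ab_group_add,finite} \<Rightarrow> 'w"
  assumes "vector_space s"
  shows "finite (alternating_maps s N)" "alternating_maps s N \<noteq> {}" "card (alternating_maps s N) > 0"
proof -
  interpret vector_space s by (rule assms)
  show "finite (alternating_maps s N)" by (rule finite_alternating_maps)
  moreover show "alternating_maps s N \<noteq> {}" by (rule alternating_maps_nonempty) simp
  ultimately show "card (alternating_maps s N) > 0" by (simp add: card_gt_0_iff)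
qed

lemma expectation_num_isotropic:
  fixes s :: "'a::{field,finite} \<Rightarrow> 'w::{ab_group_add,finite} \<Rightarrow> 'w"
  assumes s: "vector_space s"
  shows "measure_pmf.expectation (pmf_of_set (alternating_maps s N)) (\<lambda>B. real (num_isotropic N r B)) =
    real (card (subspaces_of_dim N r :: (nat \<Rightarrow> 'a) set set)) / real CARD('w) ^ (r choose 2)"
proof -
  let ?A = "alternating_maps s N" and ?S = "subspaces_of_dim N r :: (nat \<Rightarrow> 'a) set set"
  note A = alternating_maps_finite_nonempty[OF s, of N]
  have "(\<Sum>B\<in>?A. real (num_isotropic N r B)) = (\<Sum>H\<in>?S. real (card {B \<in> ?A. totally_isotropic B H}))"
    unfolding num_isotropic_def using A(1) finite_subspaces_of_dim by (rule double_count)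
  also have "\<dots> = (\<Sum>H\<in>?S. real (card ?A) / real CARD('w) ^ (r choose 2))"
  proof (rule sum.cong)
    fix H assume "H \<in> ?S"
    then have "card ?A = card {B \<in> ?A. totally_isotropic B H} * CARD('w) ^ (r choose 2)"
      using card_isotropic[OF s] by (auto simp: subspaces_of_dim_alt)
    then show "real (card {B \<in> ?A. totally_isotropic B H}) = real (card ?A) / real CARD('w) ^ (r choose 2)"
      by (simp add: field_simps)
  qed simp
  finally show ?thesis using A by (simp add: integral_pmf_of_set)
qed

text \<open>A union bound over the \<open>d\<close>-dimensional subspaces given by
  \<open>isotropic_imp_radical\<close>. Their number contributes \<open>d * (N - d)\<close> to the
  exponent and cancels that summand in \<open>card_radical_contains\<close>, leaving
  \<open>d choose 2\<close>.\<close>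

lemma prob_isotropic_le:
  fixes d :: nat
  assumes d: "d + N \<le> 2 * r" "d \<le> N"
  shows "measure (pmf_of_set (alternating_maps ((*) :: 'a::{field,finite} \<Rightarrow> 'a \<Rightarrow> 'a) N)) {B. num_isotropic N r B > 0}
    \<le> C_const CARD('a) / real CARD('a) ^ (d choose 2)"
proof -
  let ?A = "alternating_maps ((*) :: 'a \<Rightarrow> 'a \<Rightarrow> 'a) N" and ?q = "CARD('a)"
  let ?S = "subspaces_of_dim N d :: (nat \<Rightarrow> 'a) set set"
  let ?R = "\<lambda>K. {B \<in> ?A. \<forall>x\<in>K. \<forall>y\<in>coord_space N. B x y = 0}"
  let ?e = "(d choose 2) + d * (N - d)"
  note A = alternating_maps_finite_nonempty[OF vector_space_field[where 'a = 'a], of N]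
  have q: "real ?q > 1" using card_field_gt_1[where 'a = 'a] by simp
  have "?A \<inter> {B. num_isotropic N r B > 0} \<subseteq> (\<Union>K\<in>?S. ?R K)"
  proof clarify
    fix B assume B: "B \<in> ?A" and "num_isotropic N r B > 0"
    then have "{H \<in> subspaces_of_dim N r. totally_isotropic B H} \<noteq> {}"
      unfolding num_isotropic_def by (metis card.empty less_numeral_extra(3))
    then obtain H where "H \<in> subspaces_of_dim N r" "totally_isotropic B H" by blast
    then obtain K where "K \<in> ?S" "\<forall>x\<in>K. \<forall>y\<in>coord_space N. B x y = 0"
      using isotropic_imp_radical[OF B _ _ d(1)] by metis
    then show "B \<in> (\<Union>K\<in>?S. ?R K)" using B by blast
  qed
  then have "card (?A \<inter> {B. num_isotropic N r B > 0}) \<le> card (\<Union>K\<in>?S. ?R K)"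
    by (intro card_mono finite_UN_I finite_subspaces_of_dim) (use A(1) in auto)
  also have "\<dots> \<le> (\<Sum>K\<in>?S. card (?R K))"
    using finite_subspaces_of_dim by (rule card_UN_le)
  finally have "card (?A \<inter> {B. num_isotropic N r B > 0}) \<le> (\<Sum>K\<in>?S. card (?R K))" .
  then have "real (card (?A \<inter> {B. num_isotropic N r B > 0})) \<le> (\<Sum>K\<in>?S. real (card (?R K)))"
    unfolding of_nat_sum[symmetric] by (rule of_nat_mono)
  also have "\<dots> \<le> (\<Sum>K\<in>?S. real (card ?A) / real ?q ^ ?e)"
  proof (rule sum_mono)
    fix K assume "K \<in> ?S"
    then have "card (?R K) * ?q ^ ?e \<le> card ?A"
      using card_radical_contains[OF vector_space_field[where 'a = 'a]] by (auto simp: subspaces_of_dim_alt)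
    then have "real (card (?R K)) * real ?q ^ ?e \<le> real (card ?A)"
      by (simp flip: of_nat_mult of_nat_power)
    then show "real (card (?R K)) \<le> real (card ?A) / real ?q ^ ?e"
      using q by (simp add: field_simps)
  qed
  also have "\<dots> = real (card ?S) * real (card ?A) / real ?q ^ ?e" by simp
  finally have "measure (pmf_of_set ?A) {B. num_isotropic N r B > 0} \<le> real (card ?S) / real ?q ^ ?e"
    using A by (simp add: measure_pmf_of_set field_simps)
  also have "\<dots> \<le> C_const ?q * real ?q ^ (d * (N - d)) / real ?q ^ ?e"
    using card_subspaces_of_dim_le[OF d(2), where 'a = 'a] q by (intro divide_right_mono) auto
  also have "\<dots> = C_const ?q / real ?q ^ (d choose 2)" using q by (simp add: power_add)
  finally show ?thesis .
qed

text \<open>For a fixed isotropic candidate \<open>H\<close>, each intersection dimension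
  \<open>k\<close> from \<open>1\<close> to \<open>r - 1\<close> adds at least \<open>1 / Q\<close>
  to the sum of joint probabilities. The ratio is thus at least
  \<open>(r - 1) * Q / card ?S\<close>, and \<open>card ?S\<close> is at most \<open>C_const\<close>
  times \<open>Q\<close>.\<close>

lemma second_moment_ge:
  assumes r: "r \<ge> 1"
  defines "N \<equiv> 2 * r - 1"
  defines "P \<equiv> pmf_of_set (alternating_maps ((*s) :: 'a::{field,finite} \<Rightarrow> 'a ^ 2 \<Rightarrow> 'a ^ 2) N)"
  shows "(real r - 1) / C_const CARD('a) \<le>
    measure_pmf.expectation P (\<lambda>B. real (num_isotropic N r B) * (real (num_isotropic N r B) - 1))
      / (measure_pmf.expectation P (\<lambda>B. real (num_isotropic N r B)))\<^sup>2"
proof -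
  let ?s = "(*s) :: 'a \<Rightarrow> 'a ^ 2 \<Rightarrow> 'a ^ 2"
  let ?A = "alternating_maps ?s N" and ?q = "real CARD('a)"
  let ?S = "subspaces_of_dim N r :: (nat \<Rightarrow> 'a) set set"
  let ?Z = "\<lambda>H. {B \<in> ?A. totally_isotropic B H}"
  let ?M = "\<lambda>H k. {H' \<in> ?S. card (H \<inter> H') = CARD('a) ^ k}"
  define a where "a = real (card ?A)"
  \<comment> \<open>\<open>1 / Q\<close> is the probability that a given subspace is isotropic for
    both forms, and \<open>Q\<close> is also the leading power in the number of subspaces, because
    \<open>N - r = r - 1\<close>.\<close>
  define Q where "Q = ?q ^ (r * (r - 1))"
  have s: "vector_space ?s" by (rule vec.vector_space_axioms)
  note A = alternating_maps_finite_nonempty[OF s, of N]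
  have q1: "CARD('a) > 1" by (rule card_field_gt_1)
  have q: "?q > 1" using q1 by simp
  have a: "a > 0" using A(3) by (simp add: a_def)
  have Q: "Q > 0" using q by (simp add: Q_def)
  have finS: "finite ?S" by (rule finite_subspaces_of_dim)
  have w: "real CARD('a ^ 2) ^ (k choose 2) = ?q ^ (k * (k - 1))" for k
  proof -
    have "CARD('a ^ 2) = CARD('a) ^ 2" by simp
    moreover have "2 * (k choose 2) = k * (k - 1)"
      unfolding choose_two by (rule dvd_mult_div_cancel) (cases k; simp)
    ultimately show ?thesis by (simp flip: power_mult)
  qed
  have Z: "real (card (?Z H)) = a / ?q ^ (k * (k - 1))"
    if "coord.subspace H" "H \<subseteq> coord_space N" "card H = CARD('a) ^ k" for H k
  proof -
    have "a = real (card (?Z H)) * ?q ^ (k * (k - 1))"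
      using arg_cong[OF card_isotropic[OF s that], of real] by (simp only: of_nat_mult of_nat_power w a_def)
    then show ?thesis using q by (simp add: field_simps)
  qed
  have ZZ: "a * ?q ^ (k * (k - 1)) / Q\<^sup>2 \<le> real (card (?Z H \<inter> ?Z H'))"
    if H: "H \<in> ?S" and H': "H' \<in> ?M H k" for H H' k
  proof -
    have h: "coord.subspace H" "H \<subseteq> coord_space N" "card H = CARD('a) ^ r"
      using H by (auto simp: subspaces_of_dim_alt)
    have h': "coord.subspace H'" "H' \<subseteq> coord_space N" "card H' = CARD('a) ^ r"
      "card (H \<inter> H') = CARD('a) ^ k"
      using H' by (auto simp: subspaces_of_dim_alt)
    have i: "coord.subspace (H \<inter> H')" "H \<inter> H' \<subseteq> coord_space N"
      using coord.subspace_inter h h' by auto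
    have "real (card (?Z H)) * real (card (?Z H')) \<le> real (card (?Z H \<inter> ?Z H')) * real (card (?Z (H \<inter> H')))"
      using card_isotropic_both[OF s, of N H H'] by (simp only: flip: of_nat_mult)
    then have "(a / Q) * (a / Q) \<le> real (card (?Z H \<inter> ?Z H')) * (a / ?q ^ (k * (k - 1)))"
      unfolding Z[OF h] Z[OF h'(1-3)] Z[OF i h'(4)] Q_def .
    then show ?thesis using a Q q by (simp add: field_simps power2_eq_square)
  qed
  have Sk: "a / Q \<le> (\<Sum>H'\<in>?M H k. real (card (?Z H \<inter> ?Z H')))" if H: "H \<in> ?S" and k: "k \<in> {1..<r}" for H k
  proof -
    let ?e = "k * (r - k) + (r - 1) * (r - k)"
    have "CARD('a) ^ ?e \<le> card (?M H k)"
      using card_meeting_in_dim[of H r k] H k unfolding N_def by auto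
    then have c: "?q ^ ?e \<le> real (card (?M H k))" by (simp flip: of_nat_power)
    \<comment> \<open>Substituting \<open>r = k + j\<close> and \<open>k = Suc i\<close> removes the
      truncated subtractions from the exponent identity below.\<close>
    obtain j where j: "r = k + j" using k by (metis atLeastLessThan_iff le_Suc_ex less_imp_le)
    obtain i where i: "k = Suc i" using k by (cases k) auto
    have "?e + k * (k - 1) = r * (r - 1)" by (simp add: i j algebra_simps)
    then have "?q ^ ?e * ?q ^ (k * (k - 1)) = Q" by (simp add: Q_def flip: power_add)
    then have "a / Q = ?q ^ ?e * (a * ?q ^ (k * (k - 1)) / Q\<^sup>2)"
      using Q by (simp add: field_simps power2_eq_square)
    also have "\<dots> \<le> real (card (?M H k)) * (a * ?q ^ (k * (k - 1)) / Q\<^sup>2)"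
      using c a q by (intro mult_right_mono) auto
    also have "\<dots> \<le> (\<Sum>H'\<in>?M H k. real (card (?Z H \<inter> ?Z H')))"
      using ZZ[OF H] by (intro sum_bounded_below) auto
    finally show ?thesis .
  qed
  have SH: "real (r - 1) * (a / Q) \<le> (\<Sum>H'\<in>?S - {H}. real (card (?Z H \<inter> ?Z H')))" if H: "H \<in> ?S" for H
  proof -
    have "card H = CARD('a) ^ r" using H by (auto simp: subspaces_of_dim_alt)
    \<comment> \<open>The bound \<open>k < r\<close> keeps the diagonal pair out of every level, so
      all levels contribute to pairs of distinct subspaces.\<close>
    then have ne: "H' \<noteq> H" if "H' \<in> ?M H k" "k \<in> {1..<r}" for H' k
      using that q1 by auto
    have "real (r - 1) * (a / Q) = (\<Sum>k\<in>{1..<r}. a / Q)" by simp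
    also have "\<dots> \<le> (\<Sum>k\<in>{1..<r}. \<Sum>H'\<in>?M H k. real (card (?Z H \<inter> ?Z H')))"
      using Sk[OF H] by (rule sum_mono)
    also have "\<dots> = (\<Sum>H'\<in>(\<Union>k\<in>{1..<r}. ?M H k). real (card (?Z H \<inter> ?Z H')))"
      using finS q1 by (subst sum.UNION_disjoint) auto
    also have "\<dots> \<le> (\<Sum>H'\<in>?S - {H}. real (card (?Z H \<inter> ?Z H')))"
    proof (rule sum_mono2)
      show "(\<Union>k\<in>{1..<r}. ?M H k) \<subseteq> ?S - {H}" using ne by blast
    qed (use finS in auto)
    finally show ?thesis .
  qed
  have off: "real n * (real n - 1) = real (card {p \<in> Y \<times> Y. fst p \<noteq> snd p})"
    if Y: "finite Y" "card Y = n" for n and Y :: "(nat \<Rightarrow> 'a) set set"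
  proof -
    let ?D = "{p \<in> Y \<times> Y. fst p \<noteq> snd p}" and ?I = "(\<lambda>x. (x, x)) ` Y"
    have eq: "?D \<union> ?I = Y \<times> Y" by auto
    have "finite (?D \<union> ?I)" unfolding eq using Y(1) by simp
    then have "finite ?D" "finite ?I" by simp_all
    moreover have "?D \<inter> ?I = {}" by auto
    ultimately have "card (?D \<union> ?I) = card ?D + card ?I" by (rule card_Un_disjoint)
    then have "card (Y \<times> Y) = card ?D + card ?I" unfolding eq .
    moreover have "card ((\<lambda>x. (x, x)) ` Y) = n"
      using Y(2) by (subst card_image) (auto intro: inj_onI)
    ultimately have "real n * real n = real (card {p \<in> Y \<times> Y. fst p \<noteq> snd p}) + real n"
      using Y(2) by (simp add: card_cartesian_product flip: of_nat_mult of_nat_add)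
    then show ?thesis by (simp add: algebra_simps)
  qed
  let ?O = "{p \<in> ?S \<times> ?S. fst p \<noteq> snd p}"
  have "(\<Sum>B\<in>?A. real (num_isotropic N r B) * (real (num_isotropic N r B) - 1))
      = (\<Sum>B\<in>?A. real (card {p \<in> ?O. totally_isotropic B (fst p) \<and> totally_isotropic B (snd p)}))"
  proof (rule sum.cong)
    fix B
    let ?Y = "{H \<in> ?S. totally_isotropic B H}"
    have "{p \<in> ?Y \<times> ?Y. fst p \<noteq> snd p} = {p \<in> ?O. totally_isotropic B (fst p) \<and> totally_isotropic B (snd p)}"
      by auto
    moreover have "finite ?Y" using finS by simp
    ultimately show "real (num_isotropic N r B) * (real (num_isotropic N r B) - 1)
      = real (card {p \<in> ?O. totally_isotropic B (fst p) \<and> totally_isotropic B (snd p)})"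
      using off[of ?Y "num_isotropic N r B"] by (simp add: num_isotropic_def)
  qed simp
  also have "\<dots> = (\<Sum>p\<in>?O. real (card {B \<in> ?A. totally_isotropic B (fst p) \<and> totally_isotropic B (snd p)}))"
    using A(1) by (rule double_count) (use finS in auto)
  also have "\<dots> = (\<Sum>p\<in>(SIGMA H:?S. ?S - {H}). real (card (?Z (fst p) \<inter> ?Z (snd p))))"
    by (intro sum.cong arg_cong[where f = "\<lambda>X. real (card X)"]) auto
  also have "\<dots> = (\<Sum>H\<in>?S. \<Sum>H'\<in>?S - {H}. real (card (?Z H \<inter> ?Z H')))"
    using finS by (subst sum.Sigma) (auto simp: split_def)
  also have "\<dots> \<ge> (\<Sum>H\<in>?S. real (r - 1) * (a / Q))"
    using SH by (rule sum_mono)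
  finally have E2: "measure_pmf.expectation P (\<lambda>B. real (num_isotropic N r B) * (real (num_isotropic N r B) - 1))
      \<ge> real (card ?S) * (real r - 1) / Q"
    unfolding P_def using A a r by (simp add: integral_pmf_of_set a_def field_simps of_nat_diff)
  have E1: "measure_pmf.expectation P (\<lambda>B. real (num_isotropic N r B)) = real (card ?S) / Q"
    unfolding P_def expectation_num_isotropic[OF s] w Q_def ..
  have rN: "r \<le> N" "N - r = r - 1" using r by (auto simp: N_def)
  have "card ?S > 0"
  proof -
    have "CARD('a) ^ r \<le> card (coord_space N :: (nat \<Rightarrow> 'a) set)"
      using rN(1) q1 by (simp add: card_coord_space)
    then obtain K :: "(nat \<Rightarrow> 'a) set" where "coord.subspace K" "K \<subseteq> coord_space N" "card K = CARD('a) ^ r"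
      using obtain_subspace_of_card[OF subspace_coord_space finite_coord_space] by metis
    then have "K \<in> ?S" by (simp add: subspaces_of_dim_alt)
    then show ?thesis using finS by (auto simp: card_gt_0_iff)
  qed
  then have S: "real (card ?S) > 0" by simp
  have C: "real (card ?S) \<le> C_const CARD('a) * Q"
    using card_subspaces_of_dim_le[OF rN(1), where 'a = 'a] rN(2) by (simp add: Q_def)
  have "(real r - 1) / C_const CARD('a) \<le> (real r - 1) * Q / real (card ?S)"
    using C S Q r C_const_pos[OF q1] mult_left_mono[OF C, of "real r - 1"] by (simp add: field_simps)
  also have "\<dots> = (real (card ?S) * (real r - 1) / Q) / (real (card ?S) / Q)\<^sup>2"
    using S Q by (simp add: field_simps power2_eq_square)
  also have "\<dots> \<le> measure_pmf.expectation P (\<lambda>B. real (num_isotropic N r B) * (real (num_isotropic N r B) - 1))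
      / (measure_pmf.expectation P (\<lambda>B. real (num_isotropic N r B)))\<^sup>2"
    unfolding E1 by (rule divide_right_mono[OF E2]) simp
  finally show ?thesis .
qed

section \<open>Limits along odd dimensions\<close>

lemma odd_top_tendstoI:
  fixes f :: "nat \<Rightarrow> 'b::topological_space"
  assumes "(\<lambda>m. f (2 * m + 1)) \<longlonglongrightarrow> l"
  shows "(f \<longlongrightarrow> l) (inf at_top (principal {r. odd r}))"
proof -
  have "filterlim (\<lambda>r::nat. r div 2) at_top (inf at_top (principal {r. odd r}))"
  proof (rule filterlim_mono[OF _ order.refl inf_le1])
    show "filterlim (\<lambda>r::nat. r div 2) at_top at_top"
      unfolding filterlim_at_top eventually_at_top_linorder
    proof
      fix Z :: nat
      show "\<exists>N. \<forall>n\<ge>N. Z \<le> n div 2" by (intro exI[of _ "2 * Z"]) auto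
    qed
  qed
  from filterlim_compose[OF assms this]
  have "((\<lambda>r. f (2 * (r div 2) + 1)) \<longlongrightarrow> l) (inf at_top (principal {r. odd r}))" .
  moreover have "eventually (\<lambda>r. f (2 * (r div 2) + 1) = f r) (inf at_top (principal {r. odd r}))"
    unfolding eventually_inf_principal by (rule always_eventually) auto
  ultimately show ?thesis by (rule Lim_transform_eventually)
qed

text \<open>By the Weierstrass inequality the product is at least one minus the sum of the
  subtracted terms. There are \<open>2 * m + 1\<close> of them, each at most
  \<open>1 / 2 ^ (m + 1)\<close>, since \<open>i \<le> 2 * m\<close> and
  \<open>q \<ge> 2\<close>.\<close>

lemma numerator_tendsto_1:
  assumes "q > (1 :: nat)"
  shows "(\<lambda>m. \<Prod>i<2 * m + 1. 1 - 1 / real q ^ (3 * m + 1 - i)) \<longlonglongrightarrow> 1"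
proof (rule tendsto_sandwich)
  have le: "1 \<le> real q ^ n" for n using assms by (intro one_le_power) auto
  show "\<forall>\<^sub>F m in sequentially. 1 - (2 * real m + 1) / 2 ^ (m + 1)
      \<le> (\<Prod>i<2 * m + 1. 1 - 1 / real q ^ (3 * m + 1 - i))"
  proof (rule always_eventually, rule allI)
    fix m :: nat
    have "(\<Sum>i<2 * m + 1. 1 / real q ^ (3 * m + 1 - i)) \<le> (\<Sum>i<2 * m + 1. 1 / 2 ^ (m + 1))"
    proof (rule sum_mono)
      fix i assume "i \<in> {..<2 * m + 1}"
      then have "(2::real) ^ (m + 1) \<le> 2 ^ (3 * m + 1 - i)" by (intro power_increasing) auto
      also have "\<dots> \<le> real q ^ (3 * m + 1 - i)" using assms by (intro power_mono) auto
      finally show "1 / real q ^ (3 * m + 1 - i) \<le> 1 / 2 ^ (m + 1)"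
        by (intro divide_left_mono) (use assms in auto)
    qed
    also have "\<dots> = (2 * real m + 1) / 2 ^ (m + 1)" by simp
    finally have "(\<Sum>i<2 * m + 1. 1 / real q ^ (3 * m + 1 - i)) \<le> (2 * real m + 1) / 2 ^ (m + 1)" .
    moreover have "1 - (\<Sum>i<2 * m + 1. 1 / real q ^ (3 * m + 1 - i))
        \<le> (\<Prod>i<2 * m + 1. 1 - 1 / real q ^ (3 * m + 1 - i))"
    proof (rule Weierstrass_prod_ineq)
      show "1 / real q ^ (3 * m + 1 - i) \<in> {0..1}" for i
        using le[of "3 * m + 1 - i"] by (auto simp: divide_le_eq_1)
    qed
    ultimately show "1 - (2 * real m + 1) / 2 ^ (m + 1)
        \<le> (\<Prod>i<2 * m + 1. 1 - 1 / real q ^ (3 * m + 1 - i))" by linarith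
  qed
  show "\<forall>\<^sub>F m in sequentially. (\<Prod>i<2 * m + 1. 1 - 1 / real q ^ (3 * m + 1 - i)) \<le> 1"
  proof (rule always_eventually, rule allI, rule prod_le_1)
    show "0 \<le> 1 - 1 / real q ^ (3 * m + 1 - i) \<and> 1 - 1 / real q ^ (3 * m + 1 - i) \<le> 1" for m i
      using le[of "3 * m + 1 - i"] by (auto simp: divide_le_eq_1)
  qed
  show "(\<lambda>m. 1 - (2 * real m + 1) / 2 ^ (m + 1)) \<longlonglongrightarrow> 1" by real_asymp
qed simp

lemma alternating_maps_component:
  fixes B :: "(nat \<Rightarrow> 'a::field) \<Rightarrow> (nat \<Rightarrow> 'a) \<Rightarrow> 'a ^ 'n"
  assumes "B \<in> alternating_maps (*s) N"
  shows "(\<lambda>x y. B x y $ i) \<in> alternating_maps (*) N"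
  using assms unfolding alternating_maps_def by simp

theorem theorem7p1:
  fixes q :: nat
    and Forms :: "nat \<Rightarrow> ((nat \<Rightarrow> 'a::{field,finite}) \<Rightarrow> (nat \<Rightarrow> 'a) \<Rightarrow> 'a) set"
    and Pairs :: "nat \<Rightarrow> ((nat \<Rightarrow> 'a) \<Rightarrow> (nat \<Rightarrow> 'a) \<Rightarrow> 'a ^ 2) set"
  defines "q \<equiv> CARD('a)"
    and "Forms \<equiv> alternating_maps (*)"
    and "Pairs \<equiv> alternating_maps (*s)"
  shows
    "(let N = (\<lambda>r. (3 * r - 1) div 2);
         odd_top = inf at_top (principal {r. odd r});
         P = (\<lambda>r. measure_pmf (pmf_of_set (Forms (N r))));
         X = (\<lambda>r. num_isotropic (N r) r);
         bound = (\<lambda>r. C_const q * real q powr (- ((real r)\<^sup>2 - 1) / 8))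
     in ((\<lambda>r. integral\<^sup>L (P r) (\<lambda>B. real (X r B))) \<longlongrightarrow> C_const q) odd_top \<and>
        (\<forall>r. odd r \<longrightarrow> measure (P r) {B. X r B > 0} \<le> bound r) \<and>
        (bound \<longlongrightarrow> 0) odd_top \<and>
        (\<forall>\<epsilon>>0. ((\<lambda>r. measure (P r) {B. \<bar>real (X r B) - 0\<bar> > \<epsilon>}) \<longlongrightarrow> 0) odd_top))
     \<and>
     (\<forall>r\<ge>1. let N = 2 * r - 1;
         P = measure_pmf (pmf_of_set (Pairs N));
         X = num_isotropic N r;
         E = (\<lambda>f. integral\<^sup>L P f)
     in (\<forall>B\<^sub>1\<in>Forms N. \<forall>B\<^sub>2\<in>Forms N. \<exists>H\<in>subspaces_of_dim N r.
           totally_isotropic B\<^sub>1 H \<and> totally_isotropic B\<^sub>2 H) \<and>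
        (\<forall>B\<in>Pairs N. X B \<ge> 1) \<and>
        E (\<lambda>B. real (X B) * (real (X B) - 1)) / (E (\<lambda>B. real (X B)))\<^sup>2
          \<ge> (real r - 1) / C_const q)"
proof -
  have q: "q > 1" unfolding q_def by (rule card_field_gt_1)
  define N where "N = (\<lambda>r::nat. (3 * r - 1) div 2)"
  define odd_top where "odd_top = inf at_top (principal {r::nat. odd r})"
  define P where "P = (\<lambda>r. pmf_of_set (Forms (N r)))"
  define X where "X = (\<lambda>r. num_isotropic (N r) r :: ((nat \<Rightarrow> 'a) \<Rightarrow> (nat \<Rightarrow> 'a) \<Rightarrow> 'a) \<Rightarrow> nat)"
  define bound where "bound = (\<lambda>r. C_const q * real q powr (- ((real r)\<^sup>2 - 1) / 8))"
  have expect: "((\<lambda>r. measure_pmf.expectation (P r) (\<lambda>B. real (X r B))) \<longlongrightarrow> C_const q) odd_top"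
    unfolding odd_top_def
  proof (rule odd_top_tendstoI)
    have "measure_pmf.expectation (P r) (\<lambda>B. real (X r B)) =
        (\<Prod>i<r. 1 - 1 / real q ^ (3 * m + 1 - i)) * (\<Prod>j<r. inverse (1 - 1 / real q ^ Suc j))"
      if "r = 2 * m + 1" for r m
    proof -
      \<comment> \<open>The choice of \<open>N\<close> makes \<open>r * (N r - r)\<close> equal to
        \<open>r choose 2\<close>, so the powers of \<open>q\<close> cancel exactly and only the two
        products remain.\<close>
      have r: "r \<le> 3 * m + 1" "3 * m + 1 - r = m" "N r = 3 * m + 1" "r choose 2 = r * m"
        using that by (simp_all add: N_def choose_two)
      have "CARD('a) > 0" by simp
      then show ?thesis
        unfolding P_def X_def Forms_def expectation_num_isotropic[OF vector_space_field] r(3,4)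
          card_subspaces_of_dim_real[OF r(1)] r(2) q_def
        by simp
    qed
    then have "(\<lambda>m. measure_pmf.expectation (P (2 * m + 1)) (\<lambda>B. real (X (2 * m + 1) B))) =
      (\<lambda>m. (\<Prod>i<2 * m + 1. 1 - 1 / real q ^ (3 * m + 1 - i))
        * (\<Prod>j<2 * m + 1. inverse (1 - 1 / real q ^ Suc j)))"
      by blast
    moreover have "(\<lambda>m. \<Prod>j<2 * m + 1. inverse (1 - 1 / real q ^ Suc j)) \<longlonglongrightarrow> C_const q"
      using LIMSEQ_subseq_LIMSEQ[OF C_const_LIMSEQ[OF q], of "\<lambda>m. 2 * m + 1"]
      by (simp add: strict_mono_def o_def)
    ultimately show "(\<lambda>m. measure_pmf.expectation (P (2 * m + 1)) (\<lambda>B. real (X (2 * m + 1) B)))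
        \<longlonglongrightarrow> C_const q"
      using tendsto_mult[OF numerator_tendsto_1[OF q]] by force
  qed
  have prob: "measure (P r) {B. X r B > 0} \<le> bound r" if odd: "odd r" for r
  proof -
    obtain m where r: "r = 2 * m + 1" using odd by (rule oddE)
    have e: "real ((m + 1) choose 2) = ((real r)\<^sup>2 - 1) / 8"
    proof -
      have "2 * ((m + 1) choose 2) = (m + 1) * m"
        unfolding choose_two using dvd_mult_div_cancel[of 2 "(m + 1) * m"] by simp
      from arg_cong[OF this, of real] show ?thesis
        by (simp add: r power2_eq_square field_simps)
    qed
    \<comment> \<open>The radical dimension \<open>d = m + 1\<close> is the largest one allowed, as
      \<open>d + N r = 4 * m + 2 = 2 * r\<close>.\<close>
    have "measure (P r) {B. X r B > 0} \<le> C_const q / real q ^ ((m + 1) choose 2)"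
      unfolding P_def X_def Forms_def q_def by (rule prob_isotropic_le) (simp_all add: r N_def)
    also have "\<dots> = C_const q / real q powr real ((m + 1) choose 2)"
      using q by (simp add: powr_realpow)
    also have "\<dots> = bound r"
      unfolding e bound_def minus_divide_left[symmetric] powr_minus_divide by simp
    finally show ?thesis .
  qed
  have bound0: "(bound \<longlongrightarrow> 0) odd_top"
  proof -
    have "real q > 1" using q by simp
    then have "(\<lambda>r. real q powr (- ((real r)\<^sup>2 - 1) / 8)) \<longlonglongrightarrow> 0"
      by real_asymp
    from tendsto_mult_right_zero[OF this, of "C_const q"] have "bound \<longlonglongrightarrow> 0"
      unfolding bound_def .
    then show ?thesis unfolding odd_top_def by (rule tendsto_mono[OF inf_le1])
  qed
  have tail: "((\<lambda>r. measure (P r) {B. \<bar>real (X r B) - 0\<bar> > \<epsilon>}) \<longlongrightarrow> 0) odd_top" if "\<epsilon> > 0" for \<epsilon> :: real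
  proof (rule tendsto_sandwich[OF _ _ tendsto_const bound0])
    have "measure (P r) {B. \<bar>real (X r B) - 0\<bar> > \<epsilon>} \<le> bound r" if "odd r" for r
    proof -
      have "measure (P r) {B. \<bar>real (X r B) - 0\<bar> > \<epsilon>} \<le> measure (P r) {B. X r B > 0}"
        by (rule measure_pmf.finite_measure_mono) (use \<open>\<epsilon> > 0\<close> in auto)
      with prob[OF that] show ?thesis by linarith
    qed
    then show "\<forall>\<^sub>F r in odd_top. measure (P r) {B. \<bar>real (X r B) - 0\<bar> > \<epsilon>} \<le> bound r"
      unfolding odd_top_def eventually_inf_principal by (intro always_eventually) simp
  qed simp
  have exist: "\<exists>H\<in>subspaces_of_dim (2 * r - 1) r. totally_isotropic B\<^sub>1 H \<and> totally_isotropic B\<^sub>2 H"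
    if "r \<ge> 1" "B\<^sub>1 \<in> Forms (2 * r - 1)" "B\<^sub>2 \<in> Forms (2 * r - 1)" for r B\<^sub>1 B\<^sub>2
  proof -
    \<comment> \<open>Puts the odd dimension into the form of \<open>common_isotropic_exists\<close>
      with \<open>n = r - 1\<close>, whose subspace then has dimension
      \<open>n + 1 = r\<close>.\<close>
    have "card (coord_space (2 * r - 1) :: (nat \<Rightarrow> 'a) set) = CARD('a) ^ (2 * (r - 1) + 1)"
    proof -
      have "2 * r - 1 = 2 * (r - 1) + 1" using that(1) by simp
      then show ?thesis by (simp only: card_coord_space)
    qed
    from common_isotropic_exists[OF that(2,3)[unfolded Forms_def] subspace_coord_space order.refl this]
    show ?thesis using that(1) by (auto simp: subspaces_of_dim_alt)
  qed
  have ge1: "num_isotropic (2 * r - 1) r B \<ge> 1" if r: "r \<ge> 1" and B: "B \<in> Pairs (2 * r - 1)" for r B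
  proof -
    have comp: "(\<lambda>x y. B x y $ i) \<in> Forms (2 * r - 1)" for i
      using alternating_maps_component B unfolding Forms_def Pairs_def by blast
    obtain H where H: "H \<in> subspaces_of_dim (2 * r - 1) r"
      "totally_isotropic (\<lambda>x y. B x y $ 1) H" "totally_isotropic (\<lambda>x y. B x y $ 2) H"
      using exist[OF r comp comp] by metis
    have "totally_isotropic B H"
      using H(2,3) by (simp add: totally_isotropic_def vec_eq_iff forall_2)
    then have "{H \<in> subspaces_of_dim (2 * r - 1) r. totally_isotropic B H} \<noteq> {}" using H(1) by blast
    then have "num_isotropic (2 * r - 1) r B \<noteq> 0"
      unfolding num_isotropic_def by (simp add: card_eq_0_iff finite_subspaces_of_dim)
    then show ?thesis by simp
  qed
  show ?thesis
    unfolding Let_def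
    using expect prob bound0 tail exist ge1 second_moment_ge[where 'a = 'a]
    unfolding odd_top_def P_def X_def bound_def N_def Pairs_def q_def by simp
qed

end
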